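(* Let $f:\mathbb{R}^p\times\mathbb{R}^d\to\mathbb{R}$ be any feed-forward network family as defined in the context, let $\mathcal{D}$ be any distribution on $\mathbb{R}^d\times\mathbb{R}$ and $\ell:\mathbb{R}\times\mathbb{R}\to\mathbb{R}$ any loss function such that $\mathcal{L}(\theta;f)=\mathbb{E}_{(x,y)\sim\mathcal{D}}[\ell(y;f(\theta;x))]$ is finite for every $\theta\in\mathbb{R}^p$. Fix any $U\in O(d)$, any number of steps $T$, and any $\theta_0\in\mathbb{R}^p$. Let $\theta^{(\mathbb{I}_d)}_t$ denote the iterates of Shampoo (defined in the context) run on $\mathcal{L}(\cdot;f)$ from initialization $\theta_0$, and let $\theta^{(U)}_t$ denote the iterates of Shampoo, with the same $\eta,\epsilon$, run on $\mathcal{L}^{(U)}(\cdot;f)$ from initialization $(Q^{(U)})^{\top}\theta_0$. Then $$\theta_t^{(U)}=(Q^{(U)})^{\top}\theta_t^{(\mathbb{I}_d)}\qquad\text{for all }t\in\{1,\dots,T\},$$ where $Q^{(U)}=\begin{bmatrix}U^{\top}\otimes\mathbb{I}_{m_1}&0\\0&\mathbb{I}_{p-m_1d}\end{bmatrix}\in O(p)$. Moreover, the trained forward maps are equivariant: for all $t \in\{1,\dots,T\}$ and all $x\in\mathbb{R}^d$, $$f\left(\theta^{(U)}_t;x\right)=f\left(\theta^{(\mathbb{I}_d)}_t;U^{\top}x\right).$$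
   Context: Networks. Fix input dimension $d=:m_0$, a number $L\ge1$, widths $m_1,\dots,m_{L+1}$ with $m_{L+1}=1$, and activation functions $\sigma_2,\dots,\sigma_{L+1}$ applied entrywise. Parameters: $W_j\in\mathbb{R}^{m_j\times m_{j-1}}$ and $b_j\in\mathbb{R}^{m_j}$ for $1\le j\le L+1$, collected in $\theta=[\mathrm{vec}(W_1),\dots,\mathrm{vec}(W_{L+1}),b_1,\dots,b_{L+1}]\in\mathbb{R}^p$ ($\mathrm{vec}$ is column-major). Then $h_1(\theta;x)=x$, $h_j(\theta;x)=\sigma_j(W_{j-1}h_{j-1}(\theta;x)+b_{j-1})$ for $2\le j\le L+1$, and $f(\theta;x)=W_{L+1}h_{L+1}(\theta;x)+b_{L+1}$. Rotated data. For $U\in O(d)$, $\mathcal{D}^{(U)}$ is the law of $(Ux,y)$ for $(x,y)\sim\mathcal{D}$, and $\mathcal{L}^{(U)}(\theta;f)=\mathbb{E}_{(x,y)\sim\mathcal{D}^{(U)}}[\ell(y;f(\theta;x))]$. Losses are assumed differentiable in $\theta$. Shampoo on an objective $\mathcal{L}$, with stepsize $\eta>0$, $\epsilon\ge0$ and a given initialization: for each layer $j\in\{1,\dots,L+1\}$ set $L_0^{(j)}=\epsilon\mathbb{I}_{m_j}$, $R_0^{(j)}=\epsilon\mathbb{I}_{m_{j-1}}$. At step $t=0,1,\dots$, let $G_t^{(j)}\in\mathbb{R}^{m_j\times m_{j-1}}$ be the gradient of $\mathcal{L}$ at $\theta_t$ with respect to $W_j$; set $L_{t+1}^{(j)}=L_t^{(j)}+G_t^{(j)}(G_t^{(j)})^{\top}$,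 $R_{t+1}^{(j)}=R_t^{(j)}+(G_t^{(j)})^{\top}G_t^{(j)}$; and update the weight matrix of layer $j$ (as part of $\theta$) by $W_{j}\leftarrow W_{j}-\eta\,(L_{t+1}^{(j)})^{-1/4}G_t^{(j)}(R_{t+1}^{(j)})^{-1/4}$. The bias entries of $\theta$ are not changed. The matrices $L_{t+1}^{(j)},R_{t+1}^{(j)}$ are assumed invertible so that these inverse fourth roots of symmetric positive definite matrices are defined (automatic if $\epsilon>0$). *)

theory Defs
  imports "HOL-Probability.Probability" "Jordan_Normal_Form.Matrix"
begin

unbundle no vec_syntax

section \<open>Matrices\<close>

definition orthogonal_group :: "nat \<Rightarrow> real mat set" where
  "orthogonal_group n =
     {U \<in> carrier_mat n n. U\<^sup>T * U = 1\<^sub>m n \<and> U * U\<^sup>T = 1\<^sub>m n}"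

definition kronecker :: "real mat \<Rightarrow> real mat \<Rightarrow> real mat" where
  "kronecker A B = mat (dim_row A * dim_row B) (dim_col A * dim_col B)
     (\<lambda>(i, j). A $$ (i div dim_row B, j div dim_col B) * B $$ (i mod dim_row B, j mod dim_col B))"

definition spd :: "nat \<Rightarrow> real mat \<Rightarrow> bool" where
  "spd n A \<longleftrightarrow> A \<in> carrier_mat n n \<and> A\<^sup>T = A \<and>
     (\<forall>v \<in> carrier_vec n. v \<noteq> 0\<^sub>v n \<longrightarrow> scalar_prod v (A *\<^sub>v v) > 0)"

text \<open>For symmetric positive definite \<open>A\<close> this is the principal power \<open>A\<close> to the \<open>-1/4\<close>: the
  unique symmetric positive definite \<open>B\<close> whose fourth power is the inverse of \<open>A\<close>. It is
  unspecified for other \<open>A\<close>.\<close>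

definition inv_fourth_root :: "real mat \<Rightarrow> real mat" where
  "inv_fourth_root A = (THE B. spd (dim_row A) B \<and> inverts_mat (B ^\<^sub>m 4) A)"

section \<open>Gradients of functions on vectors of a given dimension\<close>

text \<open>The Frechet derivative at \<open>\<theta>\<close>, as a map from \<open>carrier_vec n\<close> with the Euclidean norm to the
  reals, is the inner product with \<open>g\<close>. The type of vectors of arbitrary dimension is not a normed
  space, so \<open>has_derivative\<close> does not apply to it.\<close>

definition vec_norm2 :: "real vec \<Rightarrow> real" where
  "vec_norm2 v = sqrt (scalar_prod v v)"

definition has_gradient :: "nat \<Rightarrow> (real vec \<Rightarrow> real) \<Rightarrow> real vec \<Rightarrow> real vec \<Rightarrow> bool" where
  "has_gradient n F g \<theta> \<longleftrightarrow> g \<in> carrier_vec n \<and>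
     (\<forall>e>0. \<exists>r>0. \<forall>v \<in> carrier_vec n. vec_norm2 v < r \<longrightarrow>
        \<bar>F (\<theta> + v) - F \<theta> - scalar_prod g v\<bar> \<le> e * vec_norm2 v)"

definition vec_differentiable :: "nat \<Rightarrow> (real vec \<Rightarrow> real) \<Rightarrow> real vec \<Rightarrow> bool" where
  "vec_differentiable n F \<theta> \<longleftrightarrow> (\<exists>g. has_gradient n F g \<theta>)"

definition gradient :: "nat \<Rightarrow> (real vec \<Rightarrow> real) \<Rightarrow> real vec \<Rightarrow> real vec" where
  "gradient n F \<theta> = (THE g. has_gradient n F g \<theta>)"

section \<open>Parameters of a feed-forward network\<close>

text \<open>Throughout, \<open>m j\<close> is the width of layer \<open>j\<close> for \<open>0 \<le> j \<le> L + 1\<close>; the weight matrix \<open>W j\<close> is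
  \<open>m j \<times> m (j - 1)\<close> and the bias \<open>b j\<close> has dimension \<open>m j\<close>, for \<open>1 \<le> j \<le> L + 1\<close>.\<close>

definition num_params :: "(nat \<Rightarrow> nat) \<Rightarrow> nat \<Rightarrow> nat" where
  "num_params m L = (\<Sum>j = 1..L + 1. m j * m (j - 1)) + (\<Sum>j = 1..L + 1. m j)"

text \<open>Column-major vectorization.\<close>

definition flatten_mat :: "real mat \<Rightarrow> real list" where
  "flatten_mat A = concat (map list_of_vec (cols A))"

definition pack :: "nat \<Rightarrow> (nat \<Rightarrow> real mat) \<Rightarrow> (nat \<Rightarrow> real vec) \<Rightarrow> real vec" where
  "pack L W b = vec_of_list
     (concat (map (\<lambda>j. flatten_mat (W j)) [1..<L + 2]) @
      concat (map (\<lambda>j. list_of_vec (b j)) [1..<L + 2]))"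

text \<open>Reading the blocks \<open>W j\<close> and \<open>b j\<close> off the parameter vector. The lemmas \<open>weight_pack\<close>,
  \<open>bias_pack\<close> and \<open>pack_weight_bias\<close> below show that this is inverse to \<open>pack\<close>.\<close>

definition weight :: "(nat \<Rightarrow> nat) \<Rightarrow> nat \<Rightarrow> real vec \<Rightarrow> real mat" where
  "weight m j \<theta> = mat (m j) (m (j - 1))
     (\<lambda>(r, c). \<theta> $ ((\<Sum>i = 1..<j. m i * m (i - 1)) + (c * m j + r)))"

definition bias :: "(nat \<Rightarrow> nat) \<Rightarrow> nat \<Rightarrow> nat \<Rightarrow> real vec \<Rightarrow> real vec" where
  "bias m L j \<theta> = vec (m j)
     (\<lambda>r. \<theta> $ ((\<Sum>i = 1..L + 1. m i * m (i - 1)) + ((\<Sum>i = 1..<j. m i) + r)))"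

lemma nth_concat_map_upt:
  assumes "a \<le> j" "j < b" "k < length (f j)"
  shows "concat (map f [a..<b]) ! ((\<Sum>i = a..<j. length (f i)) + k) = f j ! k"
proof -
  have "[a..<b] = [a..<j] @ j # [Suc j..<b]"
    using assms upt_add_eq_append[of a j "b - j"] by (simp add: upt_conv_Cons)
  moreover have "length (concat (map f [a..<j])) = (\<Sum>i = a..<j. length (f i))"
    by (simp add: length_concat interv_sum_list_conv_sum_set_nat comp_def)
  ultimately show ?thesis
    using assms(3) by (simp add: nth_append)
qed

lemma length_concat_map_upt:
  "length (concat (map f [a..<b])) = (\<Sum>i = a..<b. length (f i))"
  by (simp add: length_concat interv_sum_list_conv_sum_set_nat comp_def)

lemma flatten_mat_eq: "flatten_mat A = concat (map (\<lambda>c. list_of_vec (col A c)) [0..<dim_col A])"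
  by (simp add: flatten_mat_def cols_def comp_def)

lemma length_flatten_mat: "length (flatten_mat A) = dim_row A * dim_col A"
  by (simp add: flatten_mat_eq length_concat_map_upt del: length_concat)

lemma nth_flatten_mat:
  assumes "r < dim_row A" "c < dim_col A"
  shows "flatten_mat A ! (c * dim_row A + r) = A $$ (r, c)"
  using nth_concat_map_upt[of 0 c "dim_col A" r "\<lambda>c. list_of_vec (col A c)"] assms
  by (simp add: flatten_mat_eq list_of_vec_index)

lemma index_bound: "r < n \<Longrightarrow> c < k \<Longrightarrow> c * n + r < n * (k :: nat)"
proof -
  assume "r < n" "c < k"
  then have "c * n + r < Suc c * n" by simp
  also have "\<dots> \<le> k * n" using \<open>c < k\<close> by (intro mult_right_mono) auto
  finally show ?thesis by (simp add: mult.commute)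
qed

lemma sum_block_bound:
  fixes f :: "nat \<Rightarrow> nat"
  assumes "1 \<le> j" "j \<le> L + 1" "k < f j"
  shows "(\<Sum>i = 1..<j. f i) + k < (\<Sum>i = 1..L + 1. f i)"
proof -
  have "(\<Sum>i = 1..<j. f i) + f j = sum f {1..<Suc j}" using assms(1) by simp
  also have "\<dots> \<le> sum f {1..L + 1}" using assms(2) by (intro sum_mono2) auto
  finally show ?thesis using assms(3) by simp
qed

context
  fixes m :: "nat \<Rightarrow> nat" and L :: nat
    and W :: "nat \<Rightarrow> real mat" and b :: "nat \<Rightarrow> real vec"
  assumes W: "\<And>j. 1 \<le> j \<Longrightarrow> j \<le> L + 1 \<Longrightarrow> W j \<in> carrier_mat (m j) (m (j - 1))"
    and b: "\<And>j. 1 \<le> j \<Longrightarrow> j \<le> L + 1 \<Longrightarrow> b j \<in> carrier_vec (m j)"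
begin

lemma length_flat_weights:
  assumes "j \<le> L + 2"
  shows "(\<Sum>i = 1..<j. length (flatten_mat (W i))) = (\<Sum>i = 1..<j. m i * m (i - 1))"
proof (rule sum.cong[OF refl])
  fix i assume "i \<in> {1..<j}"
  then have "W i \<in> carrier_mat (m i) (m (i - 1))" using assms by (intro W) auto
  then show "length (flatten_mat (W i)) = m i * m (i - 1)" by (auto simp: length_flatten_mat)
qed

lemma length_flat_biases:
  assumes "j \<le> L + 2"
  shows "(\<Sum>i = 1..<j. length (list_of_vec (b i))) = (\<Sum>i = 1..<j. m i)"
proof (rule sum.cong[OF refl])
  fix i assume "i \<in> {1..<j}"
  then have "b i \<in> carrier_vec (m i)" using assms by (intro b) auto
  then show "length (list_of_vec (b i)) = m i" by auto
qed

lemma length_flat_totals: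
  "(\<Sum>i = 1..<L + 2. length (flatten_mat (W i))) = (\<Sum>i = 1..L + 1. m i * m (i - 1))"
  "(\<Sum>i = 1..<L + 2. length (list_of_vec (b i))) = (\<Sum>i = 1..L + 1. m i)"
proof -
  have eq: "{1..L + 1} = {1..<L + 2}" by auto
  show "(\<Sum>i = 1..<L + 2. length (flatten_mat (W i))) = (\<Sum>i = 1..L + 1. m i * m (i - 1))"
    unfolding eq by (rule length_flat_weights[OF order_refl])
  show "(\<Sum>i = 1..<L + 2. length (list_of_vec (b i))) = (\<Sum>i = 1..L + 1. m i)"
    unfolding eq by (rule length_flat_biases[OF order_refl])
qed

lemma pack_carrier: "pack L W b \<in> carrier_vec (num_params m L)"
  by (intro carrier_vecI)
    (simp only: pack_def dim_vec_of_list length_append length_concat_map_upt num_params_def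
      length_flat_totals)

lemma weight_pack:
  assumes "1 \<le> j" "j \<le> L + 1"
  shows "weight m j (pack L W b) = W j"
proof (rule eq_matI)
  have dims: "dim_row (W j) = m j" "dim_col (W j) = m (j - 1)" using W[OF assms] by auto
  then show "dim_row (weight m j (pack L W b)) = dim_row (W j)"
    "dim_col (weight m j (pack L W b)) = dim_col (W j)" by (auto simp: weight_def)
  fix r c assume rc: "r < dim_row (W j)" "c < dim_col (W j)"
  let ?k = "c * m j + r" and ?ws = "concat (map (\<lambda>j. flatten_mat (W j)) [1..<L + 2])"
  let ?s = "\<Sum>i = 1..<j. m i * m (i - 1)"
  have k: "?k < m j * m (j - 1)" using index_bound rc dims by simp
  have "?ws ! (?s + ?k) = flatten_mat (W j) ! ?k"
    using nth_concat_map_upt[of 1 j "L + 2" ?k "\<lambda>j. flatten_mat (W j)"]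
      length_flat_weights[of j] assms k dims by (simp add: length_flatten_mat)
  moreover have "?s + ?k < length ?ws"
    using sum_block_bound[OF assms, of ?k "\<lambda>i. m i * m (i - 1)"] k
    by (simp only: length_concat_map_upt length_flat_totals)
  ultimately have "pack L W b $ (?s + ?k) = flatten_mat (W j) ! ?k"
    by (simp only: pack_def nth_append vec_of_list_index if_True)
  then show "weight m j (pack L W b) $$ (r, c) = W j $$ (r, c)"
    using rc dims nth_flatten_mat[OF rc] by (simp add: weight_def)
qed

lemma bias_pack:
  assumes "1 \<le> j" "j \<le> L + 1"
  shows "bias m L j (pack L W b) = b j"
proof (rule eq_vecI)
  have dim: "dim_vec (b j) = m j" using b[OF assms] by auto
  then show "dim_vec (bias m L j (pack L W b)) = dim_vec (b j)" by (simp add: bias_def)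
  fix r assume r: "r < dim_vec (b j)"
  let ?ws = "concat (map (\<lambda>j. flatten_mat (W j)) [1..<L + 2])"
  let ?bs = "concat (map (\<lambda>j. list_of_vec (b j)) [1..<L + 2])"
  let ?s = "\<Sum>i = 1..<j. m i"
  have "length ?ws = (\<Sum>i = 1..L + 1. m i * m (i - 1))"
    by (simp only: length_concat_map_upt length_flat_totals)
  moreover have "?bs ! (?s + r) = list_of_vec (b j) ! r"
    using nth_concat_map_upt[of 1 j "L + 2" r "\<lambda>j. list_of_vec (b j)"]
      length_flat_biases[of j] assms r dim by simp
  ultimately have "pack L W b $ ((\<Sum>i = 1..L + 1. m i * m (i - 1)) + (?s + r)) = b j $ r"
    unfolding pack_def vec_of_list_index by (metis nth_append_length_plus list_of_vec_index)
  then show "bias m L j (pack L W b) $ r = b j $ r"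
    using r dim by (simp add: bias_def)
qed

end

lemma block_index:
  fixes f :: "nat \<Rightarrow> nat"
  assumes "k < (\<Sum>i = 1..<n. f i)"
  shows "\<exists>j l. 1 \<le> j \<and> j < n \<and> l < f j \<and> k = (\<Sum>i = 1..<j. f i) + l"
  using assms
proof (induction n)
  case (Suc n)
  show ?case
  proof (cases "k < (\<Sum>i = 1..<n. f i)")
    case True
    then show ?thesis using Suc.IH less_SucI by blast
  next
    case False
    moreover from this have "1 \<le> n" using Suc.prems by (cases n) auto
    ultimately show ?thesis using Suc.prems
      by (intro exI[of _ n] exI[of _ "k - (\<Sum>i = 1..<n. f i)"]) auto
  qed
qed simp

lemma pack_weight_bias:
  assumes "\<theta> \<in> carrier_vec (num_params m L)"
  shows "pack L (\<lambda>j. weight m j \<theta>) (\<lambda>j. bias m L j \<theta>) = \<theta>" (is "?p = \<theta>")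
proof (rule eq_vecI)
  have W: "weight m j \<theta> \<in> carrier_mat (m j) (m (j - 1))" for j by (simp add: weight_def)
  have b: "bias m L j \<theta> \<in> carrier_vec (m j)" for j by (simp add: bias_def)
  have dim: "dim_vec \<theta> = num_params m L" using assms by auto
  show "dim_vec ?p = dim_vec \<theta>"
    using pack_carrier[of L "\<lambda>j. weight m j \<theta>" m "\<lambda>j. bias m L j \<theta>", OF W b] dim by auto
  have up: "{1..<L + 2} = {1..L + 1}" by auto
  fix k assume "k < dim_vec \<theta>"
  then have k: "k < num_params m L" using dim by simp
  let ?s = "\<Sum>i = 1..L + 1. m i * m (i - 1)"
  show "?p $ k = \<theta> $ k"
  proof (cases "k < ?s")
    case True
    then obtain j l where j: "1 \<le> j" "j < L + 2" and l: "l < m j * m (j - 1)"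
      and k': "k = (\<Sum>i = 1..<j. m i * m (i - 1)) + l"
      using block_index[of k "\<lambda>i. m i * m (i - 1)" "L + 2"] unfolding up by blast
    define r c where "r = l mod m j" and "c = l div m j"
    have rc: "r < m j" "c < m (j - 1)" "l = c * m j + r"
      using l unfolding r_def c_def
      by (metis mult_is_0 mod_less_divisor neq0_conv not_less0,
          metis less_mult_imp_div_less mult.commute, simp)
    have "weight m j ?p $$ (r, c) = weight m j \<theta> $$ (r, c)"
      using weight_pack[of L "\<lambda>j. weight m j \<theta>" m "\<lambda>j. bias m L j \<theta>" j, OF W b] j by simp
    then show ?thesis using rc(1,2) unfolding k' rc(3) by (simp add: weight_def)
  next
    case False
    then have "k - ?s < (\<Sum>i = 1..<L + 2. m i)" using k by (simp only: num_params_def up)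
    then obtain j l where j: "1 \<le> j" "j < L + 2" and l: "l < m j"
      and k': "k - ?s = (\<Sum>i = 1..<j. m i) + l"
      using block_index[of "k - ?s" m "L + 2"] by blast
    then have k'': "k = ?s + ((\<Sum>i = 1..<j. m i) + l)" using False by linarith
    have "bias m L j ?p $ l = bias m L j \<theta> $ l"
      using bias_pack[of L "\<lambda>j. weight m j \<theta>" m "\<lambda>j. bias m L j \<theta>" j, OF W b] j by simp
    then show ?thesis using l unfolding k'' by (simp only: bias_def index_vec)
  qed
qed

section \<open>The network\<close>

text \<open>Layer indices start at 1; the value at index 0 is irrelevant.\<close>

primrec hidden ::
  "(nat \<Rightarrow> nat) \<Rightarrow> nat \<Rightarrow> (nat \<Rightarrow> real \<Rightarrow> real) \<Rightarrow> real vec \<Rightarrow> real vec \<Rightarrow> nat \<Rightarrow> real vec" where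
  "hidden m L \<sigma> \<theta> x 0 = x"
| "hidden m L \<sigma> \<theta> x (Suc j) =
     (if j = 0 then x
      else map_vec (\<sigma> (Suc j)) (weight m j \<theta> *\<^sub>v hidden m L \<sigma> \<theta> x j + bias m L j \<theta>))"

text \<open>The output layer has width 1; its only entry is the value of the network.\<close>

definition network ::
  "(nat \<Rightarrow> nat) \<Rightarrow> nat \<Rightarrow> (nat \<Rightarrow> real \<Rightarrow> real) \<Rightarrow> real vec \<Rightarrow> real vec \<Rightarrow> real" where
  "network m L \<sigma> \<theta> x =
     (weight m (L + 1) \<theta> *\<^sub>v hidden m L \<sigma> \<theta> x (L + 1) + bias m L (L + 1) \<theta>) $ 0"

section \<open>Data distributions and expected loss\<close>

text \<open>The Borel sigma-algebra of \<open>d\<close>-dimensional space, on \<open>carrier_vec d\<close>: transported from the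
  product sigma-algebra along the coordinates.\<close>

definition borel_vec :: "nat \<Rightarrow> real vec measure" where
  "borel_vec d = vimage_algebra (carrier_vec d) (\<lambda>v. \<lambda>i\<in>{..<d}. v $ i) (\<Pi>\<^sub>M i\<in>{..<d}. borel)"

definition data_distribution :: "nat \<Rightarrow> (real vec \<times> real) measure \<Rightarrow> bool" where
  "data_distribution d D \<longleftrightarrow> prob_space D \<and> sets D = sets (borel_vec d \<Otimes>\<^sub>M borel)"

definition rotated_data ::
  "nat \<Rightarrow> real mat \<Rightarrow> (real vec \<times> real) measure \<Rightarrow> (real vec \<times> real) measure" where
  "rotated_data d U D = distr D (borel_vec d \<Otimes>\<^sub>M borel) (\<lambda>(x, y). (U *\<^sub>v x, y))"

definition expected_loss ::
  "(real vec \<times> real) measure \<Rightarrow> (real \<Rightarrow> real \<Rightarrow> real) \<Rightarrow> (real vec \<Rightarrow> real vec \<Rightarrow> real) \<Rightarrow>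
     real vec \<Rightarrow> real" where
  "expected_loss D loss f \<theta> = (\<integral>(x, y). loss y (f \<theta> x) \<partial>D)"

section \<open>Shampoo\<close>

text \<open>The state after \<open>t\<close> steps consists of the parameter vector and of the left and right
  preconditioners of each layer, for the objective \<open>F\<close>.\<close>

primrec shampoo_state ::
  "(nat \<Rightarrow> nat) \<Rightarrow> nat \<Rightarrow> real \<Rightarrow> real \<Rightarrow> (real vec \<Rightarrow> real) \<Rightarrow> real vec \<Rightarrow> nat \<Rightarrow>
     real vec \<times> (nat \<Rightarrow> real mat) \<times> (nat \<Rightarrow> real mat)" where
  "shampoo_state m L \<eta> \<epsilon> F \<theta>0 0 =
     (\<theta>0, (\<lambda>j. \<epsilon> \<cdot>\<^sub>m 1\<^sub>m (m j)), (\<lambda>j. \<epsilon> \<cdot>\<^sub>m 1\<^sub>m (m (j - 1))))"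
| "shampoo_state m L \<eta> \<epsilon> F \<theta>0 (Suc t) =
     (let (\<theta>, Lp, Rp) = shampoo_state m L \<eta> \<epsilon> F \<theta>0 t;
          G = (\<lambda>j. weight m j (gradient (num_params m L) F \<theta>));
          Lp' = (\<lambda>j. Lp j + G j * (G j)\<^sup>T);
          Rp' = (\<lambda>j. Rp j + (G j)\<^sup>T * G j);
          W' = (\<lambda>j. weight m j \<theta> -
                      \<eta> \<cdot>\<^sub>m (inv_fourth_root (Lp' j) * G j * inv_fourth_root (Rp' j)))
      in (pack L W' (\<lambda>j. bias m L j \<theta>), Lp', Rp'))"

definition shampoo ::
  "(nat \<Rightarrow> nat) \<Rightarrow> nat \<Rightarrow> real \<Rightarrow> real \<Rightarrow> (real vec \<Rightarrow> real) \<Rightarrow> real vec \<Rightarrow> nat \<Rightarrow> real vec" where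
  "shampoo m L \<eta> \<epsilon> F \<theta>0 t = fst (shampoo_state m L \<eta> \<epsilon> F \<theta>0 t)"

definition shampoo_left ::
  "(nat \<Rightarrow> nat) \<Rightarrow> nat \<Rightarrow> real \<Rightarrow> real \<Rightarrow> (real vec \<Rightarrow> real) \<Rightarrow> real vec \<Rightarrow> nat \<Rightarrow> nat \<Rightarrow> real mat" where
  "shampoo_left m L \<eta> \<epsilon> F \<theta>0 t = fst (snd (shampoo_state m L \<eta> \<epsilon> F \<theta>0 t))"

definition shampoo_right ::
  "(nat \<Rightarrow> nat) \<Rightarrow> nat \<Rightarrow> real \<Rightarrow> real \<Rightarrow> (real vec \<Rightarrow> real) \<Rightarrow> real vec \<Rightarrow> nat \<Rightarrow> nat \<Rightarrow> real mat" where
  "shampoo_right m L \<eta> \<epsilon> F \<theta>0 t = snd (snd (shampoo_state m L \<eta> \<epsilon> F \<theta>0 t))"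

section \<open>The lifted rotation\<close>

definition lifted_rotation :: "(nat \<Rightarrow> nat) \<Rightarrow> nat \<Rightarrow> real mat \<Rightarrow> real mat" where
  "lifted_rotation m L U =
     (let q = m 1 * m 0; p = num_params m L in
      four_block_mat (kronecker (U\<^sup>T) (1\<^sub>m (m 1))) (0\<^sub>m q (p - q))
                     (0\<^sub>m (p - q) q) (1\<^sub>m (p - q)))"

end

(*
Write \<open>F\<close> for the loss and \<open>F\<^sup>U\<close> for the loss on rotated data. Since only \<open>W\<^sub>1\<close> meets the input,
\<open>F\<^sup>U \<theta> = F (Q \<theta>)\<close>, so the gradient of \<open>F\<^sup>U\<close> at \<open>Q\<^sup>T \<theta>\<close> is \<open>Q\<^sup>T\<close> applied to that of \<open>F\<close> at \<open>\<theta>\<close>.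
In the first layer this turns \<open>G\<close> into \<open>G U\<^sup>T\<close>, hence leaves \<open>L\<close> unchanged and turns \<open>R\<close> into
\<open>U R U\<^sup>T\<close>. The inverse fourth root commutes with orthogonal conjugation because it is unique, so
the update of \<open>W\<^sub>1\<close> is also multiplied by \<open>U\<^sup>T\<close> on the right, and induction on the step applies.
Existence of the root is the spectral theorem; the preconditioners are positive definite because
they are positive semidefinite and invertible.
*)
theory Submission
  imports Defs "Jordan_Normal_Form.Spectral_Radius"
begin

section \<open>Spectral theorem for real symmetric matrices\<close>

lemma scalar_prod_self_pos:
  fixes v :: "real vec"
  assumes "v \<in> carrier_vec n" "v \<noteq> 0\<^sub>v n"
  shows "0 < v \<bullet> v"
  using conjugate_square_greater_0_vec[OF assms(1)] assms(2) by simp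

lemma scalar_prod_self_ge_0: "0 \<le> v \<bullet> (v :: real vec)"
  by (simp add: scalar_prod_def sum_nonneg)

lemma scalar_prod_symmetric:
  fixes A :: "'a :: comm_semiring_0 mat"
  assumes "A \<in> carrier_mat n n" "A\<^sup>T = A" "x \<in> carrier_vec n" "y \<in> carrier_vec n"
  shows "(A *\<^sub>v x) \<bullet> y = x \<bullet> (A *\<^sub>v y)"
  using transpose_vec_mult_scalar[of A n n y x] assms by simp

text \<open>An eigenvalue \<open>a\<close> exists over the complex numbers. Splitting its
  eigenvector into real part \<open>x\<close> and imaginary part \<open>y\<close>, symmetry of
  \<open>A\<close> forces \<open>Im a\<close> to vanish, so \<open>a\<close> is a root of the real
  characteristic polynomial.\<close>

lemma symmetric_real_eigenvector:
  fixes A :: "real mat"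
  assumes A: "A \<in> carrier_mat n n" and sym: "A\<^sup>T = A" and n: "0 < n"
  obtains v k where "v \<in> carrier_vec n" "v \<noteq> 0\<^sub>v n" "A *\<^sub>v v = k \<cdot>\<^sub>v v"
proof -
  let ?C = "map_mat complex_of_real A"
  have C: "?C \<in> carrier_mat n n" using A by simp
  obtain a where "a \<in> spectrum ?C" using spectrum_non_empty[OF C n] by blast
  then have ev: "eigenvalue ?C a" by (simp add: spectrum_def)
  then obtain w where w: "w \<in> carrier_vec n" "w \<noteq> 0\<^sub>v n" "?C *\<^sub>v w = a \<cdot>\<^sub>v w"
    using A unfolding eigenvalue_def eigenvector_def by auto
  define x y where "x = map_vec Re w" and "y = map_vec Im w"
  have xy: "x \<in> carrier_vec n" "y \<in> carrier_vec n" using w(1) by (auto simp: x_def y_def)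
  have Aw: "(\<Sum>j = 0..<n. complex_of_real (A $$ (i, j)) * w $ j) = a * w $ i" if "i < n" for i
    using arg_cong[OF w(3), of "\<lambda>v. v $ i"] that A w(1) by (simp add: scalar_prod_def)
  have Ax: "A *\<^sub>v x = Re a \<cdot>\<^sub>v x - Im a \<cdot>\<^sub>v y"
  proof (rule eq_vecI)
    fix i assume "i < dim_vec (Re a \<cdot>\<^sub>v x - Im a \<cdot>\<^sub>v y)"
    then show "(A *\<^sub>v x) $ i = (Re a \<cdot>\<^sub>v x - Im a \<cdot>\<^sub>v y) $ i"
      using arg_cong[OF Aw[of i], of Re] A w(1) by (simp add: scalar_prod_def x_def y_def)
  qed (use A xy in auto)
  have Ay: "A *\<^sub>v y = Im a \<cdot>\<^sub>v x + Re a \<cdot>\<^sub>v y"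
  proof (rule eq_vecI)
    fix i assume "i < dim_vec (Im a \<cdot>\<^sub>v x + Re a \<cdot>\<^sub>v y)"
    then show "(A *\<^sub>v y) $ i = (Im a \<cdot>\<^sub>v x + Re a \<cdot>\<^sub>v y) $ i"
      using arg_cong[OF Aw[of i], of Im] A w(1) by (simp add: scalar_prod_def x_def y_def)
  qed (use A xy in auto)
  have "(A *\<^sub>v x) \<bullet> y = x \<bullet> (A *\<^sub>v y)"
    using scalar_prod_symmetric[OF A sym xy] .
  \<comment> \<open>Expanding both sides, \<open>Re a * (x \<bullet> y)\<close> cancels and
    \<open>- Im a * (y \<bullet> y) = Im a * (x \<bullet> x)\<close> remains.\<close>
  then have "Im a * (x \<bullet> x + y \<bullet> y) = 0"
    unfolding Ax Ay using xy
    by (simp add: minus_scalar_prod_distrib[of _ n] scalar_prod_add_distrib[of _ n]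
        algebra_simps)
  moreover have "x \<bullet> x + y \<bullet> y \<noteq> 0"
  proof
    assume "x \<bullet> x + y \<bullet> y = 0"
    then have "x \<bullet> x = 0" "y \<bullet> y = 0"
      using scalar_prod_self_ge_0[of x] scalar_prod_self_ge_0[of y] by linarith+
    then have xy0: "x = 0\<^sub>v n" "y = 0\<^sub>v n"
      using scalar_prod_self_pos[OF xy(1)] scalar_prod_self_pos[OF xy(2)] by fastforce+
    then have "w $ i = 0" if "i < n" for i
    proof -
      have "x $ i = Re (w $ i)" "y $ i = Im (w $ i)"
        using that w(1) by (auto simp: x_def y_def)
      then show ?thesis
        unfolding xy0 using that by (simp add: complex_eq_iff)
    qed
    then show False using w(1,2) by (auto intro!: eq_vecI)
  qed
  ultimately have a: "a = complex_of_real (Re a)" by (simp add: complex_eq_iff)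
  \<comment> \<open>The complex eigenvector is dropped here: the characteristic polynomial of
    \<open>?C\<close> is that of \<open>A\<close> with embedded coefficients, and its real root
    yields a real eigenvector.\<close>
  have "poly (char_poly ?C) (complex_of_real (Re a)) = 0"
    using ev a eigenvalue_root_char_poly[OF C] by metis
  then have "poly (char_poly A) (Re a) = 0"
    unfolding of_real_hom.char_poly_hom[OF A] by simp
  then have "eigenvalue A (Re a)" using eigenvalue_root_char_poly[OF A] by simp
  then show thesis using that A unfolding eigenvalue_def eigenvector_def by auto
qed

section \<open>Orthogonal matrices and reflections\<close>

lemma orthogonal_groupD:
  assumes "U \<in> orthogonal_group n"
  shows "U \<in> carrier_mat n n" "U\<^sup>T \<in> carrier_mat n n" "U\<^sup>T * U = 1\<^sub>m n" "U * U\<^sup>T = 1\<^sub>m n"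
  using assms by (auto simp: orthogonal_group_def)

lemma orthogonal_cancel:
  assumes U: "U \<in> orthogonal_group n" and X: "X \<in> carrier_mat n k"
  shows "U\<^sup>T * (U * X) = X" "U * (U\<^sup>T * X) = X"
  using assoc_mult_mat[of "U\<^sup>T" n n U n X k] assoc_mult_mat[of U n n "U\<^sup>T" n X k]
    orthogonal_groupD[OF U] X by simp_all

lemma orthogonal_cancel_vec:
  assumes U: "U \<in> orthogonal_group n" and v: "v \<in> carrier_vec n"
  shows "U\<^sup>T *\<^sub>v (U *\<^sub>v v) = v" "U *\<^sub>v (U\<^sup>T *\<^sub>v v) = v"
  using assoc_mult_mat_vec[of "U\<^sup>T" n n U n v] assoc_mult_mat_vec[of U n n "U\<^sup>T" n v]
    orthogonal_groupD[OF U] v by simp_all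

lemma orthogonal_group_mult:
  assumes U: "U \<in> orthogonal_group n" and V: "V \<in> orthogonal_group n"
  shows "U * V \<in> orthogonal_group n"
proof -
  note UV = orthogonal_groupD[OF U] orthogonal_groupD[OF V]
  have T: "(U * V)\<^sup>T = V\<^sup>T * U\<^sup>T" using UV by (simp add: transpose_mult[of U n n V n])
  have "V\<^sup>T * U\<^sup>T * (U * V) = V\<^sup>T * (U\<^sup>T * (U * V))"
    "U * V * (V\<^sup>T * U\<^sup>T) = U * (V * (V\<^sup>T * U\<^sup>T))"
    using UV by (simp_all add: assoc_mult_mat[of _ n n _ n _ n])
  then show ?thesis
    using UV orthogonal_cancel(1)[OF U, of V n] orthogonal_cancel(2)[OF V, of "U\<^sup>T" n]
    by (simp add: orthogonal_group_def T)
qed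

text \<open>The Householder reflection exchanging \<open>u\<close> and the first unit vector.\<close>

lemma orthogonal_first_column:
  fixes u :: "real vec"
  assumes u: "u \<in> carrier_vec n" "u \<bullet> u = 1" and n: "0 < n"
  obtains H where "H \<in> orthogonal_group n" "H *\<^sub>v unit_vec n 0 = u"
proof -
  define w where "w i = u $ i - (if i = 0 then 1 else 0)" for i
  define s where "s = (\<Sum>i = 0..<n. w i * w i)"
  have "(\<Sum>i = 0..<n. u $ i * u $ i) = 1" using u by (simp add: scalar_prod_def)
  moreover have "w i * w i = u $ i * u $ i + (if i = 0 then 1 - 2 * u $ 0 else 0)" for i
    by (auto simp: w_def algebra_simps)
  \<comment> \<open>\<open>s\<close> is the squared distance from \<open>u\<close> to the first unit
    vector; as both have length one it equals \<open>2 - 2 * u $ 0\<close>.\<close>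
  ultimately have s: "s = - 2 * w 0"
    using n by (simp add: s_def sum.distrib sum.delta w_def)
  \<comment> \<open>\<open>c\<close> is the coefficient in the reflection
    \<open>I - c w w\<^sup>T\<close>. When \<open>s = 0\<close>, \<open>u\<close> is already the
    first unit vector, and \<open>c = 0\<close> makes the reflection the identity.\<close>
  define c where "c = (if s = 0 then 0 else 2 / s)"
  have c: "c * c * s = 2 * c" by (simp add: c_def)
  \<comment> \<open>Up to sign this is the \<open>i\<close>-th coordinate of
    \<open>H e - u = 0\<close> for the first unit vector \<open>e\<close>. Away from the degenerate
    case it holds because \<open>c * w 0 = - 1\<close>.\<close>
  have w0: "w i + c * w i * w 0 = 0" if "i < n" for i
  proof (cases "s = 0")
    case True
    then have "w i * w i = 0"
      using that unfolding s_def by (subst (asm) sum_nonneg_eq_0_iff) auto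
    then show ?thesis by simp
  next
    case False
    then have "c * w 0 = - 1" using s by (simp add: c_def field_simps)
    then have "w i * (c * w 0) = - w i" by simp
    then show ?thesis by (simp add: algebra_simps)
  qed
  define H where "H = mat n n (\<lambda>(i, j). (if i = j then 1 else 0) - c * w i * w j)"
  have H: "H \<in> carrier_mat n n" by (simp add: H_def)
  have HT: "H\<^sup>T = H" by (rule eq_matI) (auto simp: H_def)
  have "H * H = 1\<^sub>m n"
  proof (rule eq_matI)
    fix i j assume ij: "i < dim_row (1\<^sub>m n :: real mat)" "j < dim_col (1\<^sub>m n :: real mat)"
    have "(H * H) $$ (i, j) =
        (\<Sum>k = 0..<n. ((if i = k then 1 else 0) - c * w i * w k) * ((if k = j then 1 else 0) - c * w k * w j))"
      using ij H by (simp add: H_def scalar_prod_def)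
    also have "\<dots> = (\<Sum>k = 0..<n. (if k = i then (if i = j then 1 else 0) - c * w i * w j else 0) -
        (if k = j then c * w i * w j else 0) + c * c * w i * w j * (w k * w k))"
      by (rule sum.cong) (auto simp: algebra_simps)
    also have "\<dots> = (if i = j then 1 else 0) - 2 * c * w i * w j + (c * c * s) * (w i * w j)"
      using ij by (simp add: sum.distrib sum_subtractf sum.delta sum_distrib_left[symmetric] s_def[symmetric])
    also have "\<dots> = 1\<^sub>m n $$ (i, j)" using ij unfolding c by simp
    finally show "(H * H) $$ (i, j) = 1\<^sub>m n $$ (i, j)" .
  qed (use H in auto)
  then have "H \<in> orthogonal_group n" using H by (simp add: orthogonal_group_def HT)
  moreover have "H *\<^sub>v unit_vec n 0 = u"
  proof (rule eq_vecI)
    fix i assume "i < dim_vec u"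
    then have "i < n" using u by simp
    then show "(H *\<^sub>v unit_vec n 0) $ i = u $ i"
      using n w0[of i] H by (simp add: H_def w_def split: if_splits)
  qed (use H u in auto)
  ultimately show thesis using that by blast
qed

text \<open>The columns of \<open>Q\<close> are the eigenvectors and \<open>l\<close> lists the
  eigenvalues; only its values below \<open>n\<close> matter. For a fixed orthogonal
  \<open>Q\<close> such matrices multiply by multiplying eigenvalues, so powers and roots reduce to
  real numbers.\<close>

definition conj_diag :: "nat \<Rightarrow> real mat \<Rightarrow> (nat \<Rightarrow> real) \<Rightarrow> real mat" where
  "conj_diag n Q l = Q * mat_diag n l * Q\<^sup>T"

lemma transpose_mat_diag: "(mat_diag n l)\<^sup>T = mat_diag n l"
  by (rule eq_matI) (auto simp: mat_diag_def)

text \<open>Induction on the dimension. Conjugating by an orthogonal matrix that carries the first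
  unit vector to a unit eigenvector splits \<open>A\<close> into a 1 by 1 block and a smaller
  symmetric block, to which the induction hypothesis applies.\<close>

lemma symmetric_diagonalization:
  fixes A :: "real mat"
  assumes "A \<in> carrier_mat n n" "A\<^sup>T = A"
  shows "\<exists>Q l. Q \<in> orthogonal_group n \<and> A = conj_diag n Q l"
  using assms
proof (induction n arbitrary: A)
  case 0
  have "(1\<^sub>m 0 :: real mat) \<in> orthogonal_group 0" by (simp add: orthogonal_group_def)
  moreover have "A = conj_diag 0 (1\<^sub>m 0) (\<lambda>_. 0)" using 0 by (intro eq_matI) (auto simp: conj_diag_def)
  ultimately show ?case by blast
next
  case (Suc n)
  note A = Suc.prems(1) and sym = Suc.prems(2)
  let ?n = "Suc n" and ?e = "unit_vec (Suc n) 0 :: real vec"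
  obtain v k where v: "v \<in> carrier_vec ?n" "v \<noteq> 0\<^sub>v ?n" "A *\<^sub>v v = k \<cdot>\<^sub>v v"
    using symmetric_real_eigenvector[OF A sym] by auto
  define u where "u = (1 / sqrt (v \<bullet> v)) \<cdot>\<^sub>v v"
  have u: "u \<in> carrier_vec ?n" using v by (simp add: u_def)
  have uu: "u \<bullet> u = 1"
    using scalar_prod_self_pos[OF v(1,2)] v(1) by (simp add: u_def field_simps)
  have Au: "A *\<^sub>v u = k \<cdot>\<^sub>v u"
    using v A by (simp add: u_def mult_mat_vec[of _ ?n ?n] smult_smult_assoc mult.commute)
  obtain H where H: "H \<in> orthogonal_group ?n" and He: "H *\<^sub>v ?e = u"
    using orthogonal_first_column[OF u uu] by auto
  note Hc = orthogonal_groupD(1,2)[OF H]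
  define M where "M = H\<^sup>T * A * H"
  have M: "M \<in> carrier_mat ?n ?n" using A Hc by (simp add: M_def)
  have MT: "M\<^sup>T = M"
    using A Hc sym by (simp add: M_def transpose_mult[of _ ?n ?n _ ?n])
  have "M *\<^sub>v ?e = H\<^sup>T *\<^sub>v (A *\<^sub>v (H *\<^sub>v ?e))"
    using A Hc by (simp add: M_def assoc_mult_mat_vec[of _ ?n ?n _ ?n])
  also have "\<dots> = k \<cdot>\<^sub>v (H\<^sup>T *\<^sub>v (H *\<^sub>v ?e))"
    unfolding He Au using mult_mat_vec[of "H\<^sup>T" ?n ?n u k] Hc u by simp
  also have "\<dots> = k \<cdot>\<^sub>v ?e" using orthogonal_cancel_vec(1)[OF H, of ?e] by simp
  finally have Me: "M *\<^sub>v ?e = k \<cdot>\<^sub>v ?e" .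
  \<comment> \<open>The first unit vector is an eigenvector of \<open>M\<close>, so the first column
    of \<open>M\<close> vanishes off the diagonal; symmetry gives the same for the first
    row.\<close>
  have M0: "M $$ (i, 0) = (if i = 0 then k else 0)" if "i < ?n" for i
    using arg_cong[OF Me, of "\<lambda>v. v $ i"] that M by simp
  have M0': "M $$ (0, i) = (if i = 0 then k else 0)" if "i < ?n" for i
    using M0[OF that] arg_cong[OF MT, of "\<lambda>B. B $$ (i, 0)"] that M by simp
  define N where "N = mat n n (\<lambda>(i, j). M $$ (Suc i, Suc j))"
  have N: "N \<in> carrier_mat n n" by (simp add: N_def)
  have "M $$ (j, i) = M $$ (i, j)" if "i < ?n" "j < ?n" for i j
    using arg_cong[OF MT, of "\<lambda>B. B $$ (i, j)"] that M by simp
  then have "N\<^sup>T = N" by (intro eq_matI) (auto simp: N_def)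
  then obtain P l where P: "P \<in> orthogonal_group n" and NP: "N = conj_diag n P l"
    using Suc.IH[OF N] by blast
  note Pc = orthogonal_groupD[OF P]
  let ?z = "0\<^sub>m 1 n :: real mat" and ?z' = "0\<^sub>m n 1 :: real mat"
  let ?l = "\<lambda>i. case i of 0 \<Rightarrow> k | Suc j \<Rightarrow> l j"
  define K where "K = mat_diag 1 (\<lambda>_. k)"
  have K: "K \<in> carrier_mat 1 1" by (simp add: K_def)
  \<comment> \<open>\<open>B\<close> fixes the first coordinate and acts as \<open>P\<close> on the
    others; \<open>H * B\<close> will be the diagonalizing matrix.\<close>
  define B where "B = four_block_mat (1\<^sub>m 1) ?z ?z' P"
  have BT: "B\<^sup>T = four_block_mat (1\<^sub>m 1) ?z ?z' (P\<^sup>T)"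
    unfolding B_def using Pc by (subst transpose_four_block_mat[of _ 1 1 _ n _ n]) auto
  have blocks: "four_block_mat X ?z ?z' Y * four_block_mat X' ?z ?z' Y' =
      four_block_mat (X * X') ?z ?z' (Y * Y')"
    if "X \<in> carrier_mat 1 1" "X' \<in> carrier_mat 1 1" "Y \<in> carrier_mat n n" "Y' \<in> carrier_mat n n"
    for X X' Y Y'
    using that by (simp add: mult_four_block_mat[of _ 1 1 _ n _ n _ _ 1 _ n] del: One_nat_def)
  have "B \<in> carrier_mat (1 + n) (1 + n)"
    unfolding B_def by (rule four_block_carrier_mat) (use Pc in auto)
  then have Bc: "B \<in> carrier_mat ?n ?n" by simp
  have "B * B\<^sup>T = 1\<^sub>m ?n" "B\<^sup>T * B = 1\<^sub>m ?n"
    unfolding BT unfolding B_def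
    using Pc by (simp_all add: blocks plus_1_eq_Suc del: One_nat_def)
  then have B: "B \<in> orthogonal_group ?n" using Bc by (simp add: orthogonal_group_def)
  have D: "mat_diag ?n ?l = four_block_mat K ?z ?z' (mat_diag n l)"
    by (rule eq_matI) (auto simp: mat_diag_def K_def split: nat.splits)
  have "M = four_block_mat K ?z ?z' N"
    using M M0 M0' by (intro eq_matI) (auto simp: mat_diag_def K_def N_def)
  also have "\<dots> = B * mat_diag ?n ?l * B\<^sup>T"
    unfolding BT D NP conj_diag_def unfolding B_def using Pc K
    by (simp add: blocks mult_carrier_mat[of _ n n _ n] del: One_nat_def)
  finally have MB: "M = B * mat_diag ?n ?l * B\<^sup>T" .
  have "A = H * (H\<^sup>T * (A * (H * H\<^sup>T)))"
    using A Hc orthogonal_cancel(2)[OF H A] orthogonal_groupD(4)[OF H] by simp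
  also have "\<dots> = H * M * H\<^sup>T"
    using A Hc by (simp add: M_def assoc_mult_mat[of _ ?n ?n _ ?n _ ?n])
  also have "\<dots> = conj_diag ?n (H * B) ?l"
    using Hc Bc by (simp add: MB mult_carrier_mat[of _ ?n ?n _ ?n] conj_diag_def transpose_mult[of _ ?n ?n _ ?n]
        assoc_mult_mat[of _ ?n ?n _ ?n _ ?n])
  finally have "A = conj_diag ?n (H * B) ?l" .
  then show ?case using orthogonal_group_mult[OF H B] by blast
qed

section \<open>Inverse fourth roots of positive definite matrices\<close>

lemma mult_carrier_square [simp]:
  "A \<in> carrier_mat n n \<Longrightarrow> B \<in> carrier_mat n n \<Longrightarrow> A * B \<in> carrier_mat n n"
  by (rule mult_carrier_mat)

lemma zero_mult_mat_vec: "v \<in> carrier_vec n \<Longrightarrow> 0\<^sub>m k n *\<^sub>v v = (0\<^sub>v k :: real vec)"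
  by (rule eq_vecI) (auto simp: scalar_prod_def)

section \<open>Algebra of matrices diagonal in a common orthonormal basis\<close>

lemma conj_diag_carrier:
  "Q \<in> orthogonal_group n \<Longrightarrow> conj_diag n Q l \<in> carrier_mat n n"
  using orthogonal_groupD[of Q n] by (simp add: conj_diag_def mult_carrier_mat[of _ n n _ n])

lemma conj_diag_mult:
  assumes Q: "Q \<in> orthogonal_group n"
  shows "conj_diag n Q l * conj_diag n Q k = conj_diag n Q (\<lambda>i. l i * k i)"
proof -
  note [simp] = orthogonal_groupD(1,2)[OF Q] assoc_mult_mat[of _ n n _ n _ n]
  have "conj_diag n Q l * conj_diag n Q k =
      Q * (mat_diag n l * (Q\<^sup>T * (Q * (mat_diag n k * Q\<^sup>T))))"
    by (simp add: conj_diag_def)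
  also have "\<dots> = Q * (mat_diag n l * (mat_diag n k * Q\<^sup>T))"
    by (subst orthogonal_cancel(1)[OF Q, of _ n]) simp_all
  also have "\<dots> = Q * (mat_diag n l * mat_diag n k) * Q\<^sup>T" by (simp del: mat_diag_diag)
  finally show ?thesis by (simp add: conj_diag_def)
qed

lemma conj_diag_one: "Q \<in> orthogonal_group n \<Longrightarrow> conj_diag n Q (\<lambda>_. 1) = 1\<^sub>m n"
  using orthogonal_groupD[of Q n] by (simp add: conj_diag_def)

lemma conj_diag_transpose:
  assumes "Q \<in> orthogonal_group n"
  shows "(conj_diag n Q l)\<^sup>T = conj_diag n Q l"
  using orthogonal_groupD[OF assms]
  by (simp add: conj_diag_def transpose_mult[of _ n n _ n] transpose_mat_diag
      assoc_mult_mat[of _ n n _ n _ n])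

lemma mat_diag_mult_vec:
  fixes l :: "nat \<Rightarrow> real"
  assumes "v \<in> carrier_vec n"
  shows "mat_diag n l *\<^sub>v v = vec n (\<lambda>i. l i * v $ i)"
proof (rule eq_vecI)
  fix i assume "i < dim_vec (vec n (\<lambda>i. l i * v $ i))"
  then have i: "i < n" by simp
  have "(mat_diag n l *\<^sub>v v) $ i = (\<Sum>k = 0..<n. (if i = k then l k else 0) * v $ k)"
    using i assms by (simp add: mat_diag_def scalar_prod_def)
  also have "\<dots> = (\<Sum>k = 0..<n. if k = i then l i * v $ i else 0)"
    by (rule sum.cong) auto
  finally show "(mat_diag n l *\<^sub>v v) $ i = vec n (\<lambda>i. l i * v $ i) $ i"
    using i by (simp add: sum.delta)
qed (simp add: mat_diag_def)

lemma conj_diag_mult_vec: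
  assumes Q: "Q \<in> orthogonal_group n" and v: "v \<in> carrier_vec n"
  shows "conj_diag n Q l *\<^sub>v v = Q *\<^sub>v (mat_diag n l *\<^sub>v (Q\<^sup>T *\<^sub>v v))"
  using orthogonal_groupD[OF Q] v
  by (simp add: conj_diag_def assoc_mult_mat_vec[of _ n n _ n] mult_carrier_mat[of _ n n _ n])

text \<open>In the coordinates \<open>Q\<^sup>T v\<close> the quadratic form is diagonal, so
  definiteness becomes a statement about the signs of \<open>l\<close>.\<close>

lemma conj_diag_quadratic_form:
  assumes Q: "Q \<in> orthogonal_group n" and v: "v \<in> carrier_vec n"
  shows "v \<bullet> (conj_diag n Q l *\<^sub>v v) = (\<Sum>i<n. l i * ((Q\<^sup>T *\<^sub>v v) $ i)\<^sup>2)"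
proof -
  have Qv: "Q\<^sup>T *\<^sub>v v \<in> carrier_vec n" using orthogonal_groupD[OF Q] v by simp
  have D: "mat_diag n l *\<^sub>v (Q\<^sup>T *\<^sub>v v) \<in> carrier_vec n" 
    by (rule mult_mat_vec_carrier[OF mat_diag_dim Qv])
  have "v \<bullet> (conj_diag n Q l *\<^sub>v v) = (Q\<^sup>T *\<^sub>v v) \<bullet> (mat_diag n l *\<^sub>v (Q\<^sup>T *\<^sub>v v))"
    unfolding conj_diag_mult_vec[OF Q v]
    using transpose_vec_mult_scalar[OF orthogonal_groupD(1)[OF Q] D v] by simp
  then show ?thesis
    using orthogonal_groupD[OF Q] v
    by (simp add: mat_diag_mult_vec[OF Qv] scalar_prod_def power2_eq_square mult_ac atLeast0LessThan
          del: index_mult_mat_vec)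
qed

lemma conj_diag_column:
  assumes Q: "Q \<in> orthogonal_group n" and i: "i < n"
  shows "Q *\<^sub>v unit_vec n i \<in> carrier_vec n" "Q *\<^sub>v unit_vec n i \<noteq> 0\<^sub>v n"
    "conj_diag n Q l *\<^sub>v (Q *\<^sub>v unit_vec n i) = l i \<cdot>\<^sub>v (Q *\<^sub>v unit_vec n i)"
proof -
  note Qc = orthogonal_groupD(1,2)[OF Q]
  have e: "unit_vec n i \<in> carrier_vec n" by simp
  show c: "Q *\<^sub>v unit_vec n i \<in> carrier_vec n" using Qc by simp
  show "Q *\<^sub>v unit_vec n i \<noteq> 0\<^sub>v n"
  proof
    assume "Q *\<^sub>v unit_vec n i = 0\<^sub>v n"
    then have "unit_vec n i = Q\<^sup>T *\<^sub>v 0\<^sub>v n" using orthogonal_cancel_vec(1)[OF Q e] by simp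
    then have "unit_vec n i $ i = (0 :: real)" using Qc i by simp
    then show False using i by simp
  qed
  have "mat_diag n l *\<^sub>v unit_vec n i = l i \<cdot>\<^sub>v unit_vec n i"
    unfolding mat_diag_mult_vec[OF e] using i by (intro eq_vecI) auto
  then show "conj_diag n Q l *\<^sub>v (Q *\<^sub>v unit_vec n i) = l i \<cdot>\<^sub>v (Q *\<^sub>v unit_vec n i)"
    unfolding conj_diag_mult_vec[OF Q c] orthogonal_cancel_vec(1)[OF Q e]
    using mult_mat_vec[OF Qc(1) e] by simp
qed

section \<open>Positive definiteness in terms of eigenvalues\<close>

lemma spdD:
  assumes "spd n A"
  shows "A \<in> carrier_mat n n" "A\<^sup>T = A"
    "v \<in> carrier_vec n \<Longrightarrow> v \<noteq> 0\<^sub>v n \<Longrightarrow> 0 < v \<bullet> (A *\<^sub>v v)"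
  using assms by (auto simp: spd_def)

lemma spd_diagonalization:
  assumes "spd n A"
  obtains Q l where "Q \<in> orthogonal_group n" "A = conj_diag n Q l" "\<And>i. i < n \<Longrightarrow> 0 < l i"
proof -
  obtain Q l where Q: "Q \<in> orthogonal_group n" and A: "A = conj_diag n Q l"
    using symmetric_diagonalization[of A n] spdD[OF assms] by blast
  have "0 < l i" if i: "i < n" for i
  proof -
    note c = conj_diag_column[OF Q i]
    have "0 < l i * ((Q *\<^sub>v unit_vec n i) \<bullet> (Q *\<^sub>v unit_vec n i))"
      using spdD(3)[OF assms c(1,2)] c(1) by (simp add: A c(3))
    then show ?thesis using scalar_prod_self_pos[OF c(1,2)] by (simp add: zero_less_mult_iff)
  qed
  then show thesis using that Q A by blast
qed

lemma spd_conj_diag: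
  assumes Q: "Q \<in> orthogonal_group n" and l: "\<And>i. i < n \<Longrightarrow> 0 < l i"
  shows "spd n (conj_diag n Q l)"
  unfolding spd_def
proof (intro conjI ballI impI)
  fix v :: "real vec" assume v: "v \<in> carrier_vec n" "v \<noteq> 0\<^sub>v n"
  define w where "w = Q\<^sup>T *\<^sub>v v"
  have w: "w \<in> carrier_vec n" using orthogonal_groupD[OF Q] v by (simp add: w_def)
  have "w \<noteq> 0\<^sub>v n"
  proof
    assume "w = 0\<^sub>v n"
    then have "v = Q *\<^sub>v 0\<^sub>v n" using orthogonal_cancel_vec(2)[OF Q v(1)] by (simp add: w_def)
    then show False using orthogonal_groupD(1)[OF Q] v(2) by auto
  qed
  then obtain i where i: "i < n" "w $ i \<noteq> 0" using w by (metis eq_vecI carrier_vecD index_zero_vec)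
  have "0 < (\<Sum>i<n. l i * (w $ i)\<^sup>2)"
  proof (rule sum_pos2[of _ i])
    show "0 < l i * (w $ i)\<^sup>2" using i l by simp
  qed (use i l in \<open>auto simp: less_imp_le\<close>)
  then show "0 < v \<bullet> (conj_diag n Q l *\<^sub>v v)"
    using conj_diag_quadratic_form[OF Q v(1)] by (simp add: w_def)
qed (use conj_diag_carrier[OF Q] conj_diag_transpose[OF Q] in auto)

text \<open>If \<open>B * B = C * C\<close> then \<open>X = B - C\<close> is symmetric with \<open>B * X + X * C = 0\<close>; on an eigenvector
  \<open>v\<close> of \<open>X\<close> for the eigenvalue \<open>k\<close> this gives \<open>k * (v \<bullet> B v + v \<bullet> C v) = 0\<close>, so \<open>k = 0\<close>.\<close>

lemma spd_sqrt_unique: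
  assumes B: "spd n B" and C: "spd n C" and eq: "B * B = C * C"
  shows "B = C"
proof -
  note Bc = spdD[OF B] and Cc = spdD[OF C]
  define X where "X = B - C"
  have X: "X \<in> carrier_mat n n" using Bc Cc by (auto simp: X_def)
  have XT: "X\<^sup>T = X" using Bc(1,2) Cc(1,2) by (simp add: X_def transpose_minus[of _ n n])
  obtain Q l where Q: "Q \<in> orthogonal_group n" and XQ: "X = conj_diag n Q l"
    using symmetric_diagonalization[OF X XT] by blast
  have "l i = 0" if i: "i < n" for i
  proof -
    define v where "v = Q *\<^sub>v unit_vec n i"
    have v: "v \<in> carrier_vec n" "v \<noteq> 0\<^sub>v n" "X *\<^sub>v v = l i \<cdot>\<^sub>v v"
      using conj_diag_column[OF Q i] unfolding v_def XQ by auto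
    have BX: "B * X + X * C = 0\<^sub>m n n"
      using Bc(1) Cc(1) eq
      by (simp add: X_def mult_minus_distrib_mat[of _ n n _ n] minus_mult_distrib_mat[of _ n n _ _ n])
        (intro eq_matI, auto)
    have "v \<bullet> ((B * X + X * C) *\<^sub>v v) = v \<bullet> (B *\<^sub>v (X *\<^sub>v v)) + v \<bullet> (X *\<^sub>v (C *\<^sub>v v))"
      using Bc(1) Cc(1) X v
      by (simp add: add_mult_distrib_mat_vec[of _ n n] assoc_mult_mat_vec[of _ n n _ n]
          scalar_prod_add_distrib[of _ n])
    also have "v \<bullet> (X *\<^sub>v (C *\<^sub>v v)) = (X *\<^sub>v v) \<bullet> (C *\<^sub>v v)"
      using scalar_prod_symmetric[OF X XT v(1), of "C *\<^sub>v v"] Cc(1) v by simp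
    also have "v \<bullet> (B *\<^sub>v (X *\<^sub>v v)) = l i * (v \<bullet> (B *\<^sub>v v))"
      unfolding v(3) using Bc(1) v(1) by (simp add: mult_mat_vec[of _ n n])
    also have "(X *\<^sub>v v) \<bullet> (C *\<^sub>v v) = l i * (v \<bullet> (C *\<^sub>v v))"
      unfolding v(3) using Cc(1) v(1) by simp
    finally have "l i * (v \<bullet> (B *\<^sub>v v) + v \<bullet> (C *\<^sub>v v)) = 0"
      using v(1) by (simp add: BX zero_mult_mat_vec algebra_simps)
    moreover have "0 < v \<bullet> (B *\<^sub>v v) + v \<bullet> (C *\<^sub>v v)"
      using Bc(3)[OF v(1,2)] Cc(3)[OF v(1,2)] by simp
    ultimately show ?thesis by simp
  qed
  then have "mat_diag n l = 0\<^sub>m n n" by (intro eq_matI) (auto simp: mat_diag_def)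
  then have X0: "X = 0\<^sub>m n n"
    using orthogonal_groupD[OF Q] by (simp add: XQ conj_diag_def)
  have "B $$ (i, j) = C $$ (i, j)" if "i < n" "j < n" for i j
    using that arg_cong[OF X0, of "\<lambda>M. M $$ (i, j)"] Bc(1) Cc(1) by (simp add: X_def)
  then show ?thesis using Bc(1) Cc(1) by (intro eq_matI) auto
qed

lemma spd_square:
  assumes "spd n B"
  shows "spd n (B * B)"
proof -
  obtain Q l where Q: "Q \<in> orthogonal_group n" "B = conj_diag n Q l" "\<And>i. i < n \<Longrightarrow> 0 < l i"
    using spd_diagonalization[OF assms] by blast
  then show ?thesis by (simp add: conj_diag_mult spd_conj_diag)
qed

lemma pow_mat_4:
  assumes "B \<in> carrier_mat n n"
  shows "B ^\<^sub>m 4 = (B * B) * (B * B)"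
  using assms by (simp add: eval_nat_numeral assoc_mult_mat[of _ n n _ n _ n])

text \<open>Both fourth powers are inverse to \<open>A\<close>, hence equal. Uniqueness of square
  roots, applied first to the squares and then to \<open>B\<close> and \<open>C\<close>, finishes
  the proof.\<close>

lemma inverse_fourth_root_unique:
  assumes A: "A \<in> carrier_mat n n" and B: "spd n B" and C: "spd n C"
    and BA: "B ^\<^sub>m 4 * A = 1\<^sub>m n" and CA: "C ^\<^sub>m 4 * A = 1\<^sub>m n"
  shows "B = C"
proof -
  have B4: "B ^\<^sub>m 4 \<in> carrier_mat n n" and C4: "C ^\<^sub>m 4 \<in> carrier_mat n n"
    using spdD(1)[OF B] spdD(1)[OF C] by auto
  have "B ^\<^sub>m 4 = (C ^\<^sub>m 4 * A) * B ^\<^sub>m 4" using CA left_mult_one_mat[OF B4] by simp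
  also have "\<dots> = C ^\<^sub>m 4 * (A * B ^\<^sub>m 4)" using A B4 C4 by simp
  also have "\<dots> = C ^\<^sub>m 4" using mat_mult_left_right_inverse[OF B4 A BA] right_mult_one_mat[OF C4] by simp
  finally have "(B * B) * (B * B) = (C * C) * (C * C)"
    by (simp add: pow_mat_4[OF spdD(1)[OF B]] pow_mat_4[OF spdD(1)[OF C]])
  from spd_sqrt_unique[OF spd_square[OF B] spd_square[OF C] this]
  show ?thesis by (rule spd_sqrt_unique[OF B C])
qed

text \<open>Keep the eigenvectors and raise each eigenvalue to the power
  \<open>-1/4\<close>.\<close>

lemma inverse_fourth_root_exists:
  assumes "spd n A"
  shows "\<exists>B. spd n B \<and> B ^\<^sub>m 4 * A = 1\<^sub>m n"
proof -
  obtain Q l where Q: "Q \<in> orthogonal_group n" and A: "A = conj_diag n Q l"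
    and l: "\<And>i. i < n \<Longrightarrow> 0 < l i"
    using spd_diagonalization[OF assms] by blast
  let ?k = "\<lambda>i. l i powr (- (1 / 4))"
  have k: "?k i * ?k i * (?k i * ?k i) * l i = 1" if "i < n" for i
    using l[OF that] by (simp add: powr_add[symmetric] powr_minus field_simps)
  have "conj_diag n Q ?k ^\<^sub>m 4 * A = conj_diag n Q (\<lambda>i. ?k i * ?k i * (?k i * ?k i) * l i)"
    by (simp add: pow_mat_4[OF conj_diag_carrier[OF Q]] conj_diag_mult[OF Q] A)
  \<comment> \<open>The identity \<open>k\<close> is known below \<open>n\<close> only, so the
    eigenvalue functions themselves may differ; the comparison is made on the diagonal
    matrices.\<close>
  also have "mat_diag n (\<lambda>i. ?k i * ?k i * (?k i * ?k i) * l i) = mat_diag n (\<lambda>_. 1)"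
    unfolding mat_diag_def by (rule eq_matI) (auto simp: k)
  then have "conj_diag n Q (\<lambda>i. ?k i * ?k i * (?k i * ?k i) * l i) = 1\<^sub>m n"
    using conj_diag_one[OF Q] unfolding conj_diag_def by simp
  finally have "conj_diag n Q ?k ^\<^sub>m 4 * A = 1\<^sub>m n" .
  moreover have "spd n (conj_diag n Q ?k)"
    by (rule spd_conj_diag[OF Q]) (simp add: l less_imp_neq[symmetric])
  ultimately show ?thesis by blast
qed

lemma inv_fourth_root_eqI:
  assumes A: "A \<in> carrier_mat n n" and B: "spd n B" "B ^\<^sub>m 4 * A = 1\<^sub>m n"
  shows "inv_fourth_root A = B"
  unfolding inv_fourth_root_def inverts_mat_def
proof (rule the_equality)
  show "spd (dim_row A) B \<and> B ^\<^sub>m 4 * A = 1\<^sub>m (dim_row (B ^\<^sub>m 4))"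
    using A B spdD(1)[OF B(1)] by auto
  fix C assume C: "spd (dim_row A) C \<and> C ^\<^sub>m 4 * A = 1\<^sub>m (dim_row (C ^\<^sub>m 4))"
  then have "spd n C" "C ^\<^sub>m 4 * A = 1\<^sub>m n" using A spdD(1)[of n C] by auto
  then show "C = B" using inverse_fourth_root_unique[OF A _ B(1) _ B(2)] by blast
qed

lemma inv_fourth_root_spd:
  assumes "spd n A"
  shows "spd n (inv_fourth_root A)" "inv_fourth_root A ^\<^sub>m 4 * A = 1\<^sub>m n"
  using inverse_fourth_root_exists[OF assms] inv_fourth_root_eqI[OF spdD(1)[OF assms]] by auto

lemma spd_conjugate:
  assumes U: "U \<in> orthogonal_group n" and A: "spd n A"
  shows "spd n (U * A * U\<^sup>T)"
proof -
  obtain Q l where Q: "Q \<in> orthogonal_group n" and AQ: "A = conj_diag n Q l"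
    and l: "\<And>i. i < n \<Longrightarrow> 0 < l i"
    using spd_diagonalization[OF A] by blast
  have "U * A * U\<^sup>T = conj_diag n (U * Q) l"
    using orthogonal_groupD(1,2)[OF U] orthogonal_groupD(1,2)[OF Q]
    by (simp add: AQ conj_diag_def transpose_mult[of _ n n _ n] assoc_mult_mat[of _ n n _ n _ n])
  then show ?thesis using spd_conj_diag[OF orthogonal_group_mult[OF U Q] l] by simp
qed

text \<open>The inner \<open>U\<^sup>T * U\<close> cancels. Conjugation therefore passes through the
  fourth power of a root.\<close>

lemma orthogonal_conjugate_mult:
  assumes U: "U \<in> orthogonal_group n" and A: "A \<in> carrier_mat n n" and B: "B \<in> carrier_mat n n"
  shows "(U * A * U\<^sup>T) * (U * B * U\<^sup>T) = U * (A * B) * U\<^sup>T"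
proof -
  note [simp] = orthogonal_groupD(1,2)[OF U] A B assoc_mult_mat[of _ n n _ n _ n]
  have "(U * A * U\<^sup>T) * (U * B * U\<^sup>T) = U * (A * (U\<^sup>T * (U * (B * U\<^sup>T))))" by simp
  also have "\<dots> = U * (A * B) * U\<^sup>T"
    by (subst orthogonal_cancel(1)[OF U, of _ n]) simp_all
  finally show ?thesis .
qed

text \<open>The conjugated root is positive definite and its fourth power inverts the conjugated
  matrix, so uniqueness identifies it as the root.\<close>

lemma inv_fourth_root_conjugate:
  assumes U: "U \<in> orthogonal_group n" and A: "spd n A"
  shows "inv_fourth_root (U * A * U\<^sup>T) = U * inv_fourth_root A * U\<^sup>T"
proof (rule inv_fourth_root_eqI)
  let ?B = "inv_fourth_root A"
  note B = inv_fourth_root_spd[OF A]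
  note Bc = spdD(1)[OF B(1)] and Ac = spdD(1)[OF A] and Uc = orthogonal_groupD(1,2)[OF U]
  show "U * A * U\<^sup>T \<in> carrier_mat n n" using Ac Uc by simp
  show "spd n (U * ?B * U\<^sup>T)" by (rule spd_conjugate[OF U B(1)])
  have "(U * ?B * U\<^sup>T) ^\<^sub>m 4 * (U * A * U\<^sup>T) = U * (?B ^\<^sub>m 4 * A) * U\<^sup>T"
    using Bc Ac Uc by (simp add: pow_mat_4[of _ n] orthogonal_conjugate_mult[OF U]
        del: assoc_mult_mat)
  then show "(U * ?B * U\<^sup>T) ^\<^sub>m 4 * (U * A * U\<^sup>T) = 1\<^sub>m n"
    using B(2) Uc orthogonal_groupD(4)[OF U] by simp
qed

text \<open>With \<open>\<epsilon> = 0\<close> the preconditioners start at zero, so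
  semidefiniteness is the property kept at every step; invertibility upgrades it to
  \<open>spd\<close>.\<close>

definition psd :: "nat \<Rightarrow> real mat \<Rightarrow> bool" where
  "psd n A \<longleftrightarrow> A \<in> carrier_mat n n \<and> A\<^sup>T = A \<and> (\<forall>v \<in> carrier_vec n. 0 \<le> v \<bullet> (A *\<^sub>v v))"

lemma psd_add: "psd n A \<Longrightarrow> psd n B \<Longrightarrow> psd n (A + B)"
  by (auto simp: psd_def transpose_add[of _ n n] add_mult_distrib_mat_vec[of _ n n]
      scalar_prod_add_distrib[of _ n])

lemma psd_scaled_one: "0 \<le> c \<Longrightarrow> psd n (c \<cdot>\<^sub>m 1\<^sub>m n)"
proof -
  assume c: "0 \<le> c"
  have "(c \<cdot>\<^sub>m 1\<^sub>m n) *\<^sub>v v = c \<cdot>\<^sub>v v" if "v \<in> carrier_vec n" for v :: "real vec"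
  proof (rule eq_vecI)
    fix i assume "i < dim_vec (c \<cdot>\<^sub>v v)"
    then show "((c \<cdot>\<^sub>m 1\<^sub>m n) *\<^sub>v v) $ i = (c \<cdot>\<^sub>v v) $ i" using that by simp
  qed (use that in auto)
  moreover have "(c \<cdot>\<^sub>m 1\<^sub>m n)\<^sup>T = c \<cdot>\<^sub>m 1\<^sub>m n" by (rule eq_matI) auto
  ultimately show ?thesis using c by (simp add: psd_def scalar_prod_self_ge_0)
qed

lemma psd_gram:
  assumes G: "G \<in> carrier_mat n k"
  shows "psd n (G * G\<^sup>T)"
  unfolding psd_def
proof (intro conjI ballI)
  fix v :: "real vec" assume v: "v \<in> carrier_vec n"
  have "v \<bullet> ((G * G\<^sup>T) *\<^sub>v v) = (G\<^sup>T *\<^sub>v v) \<bullet> (G\<^sup>T *\<^sub>v v)"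
    using transpose_vec_mult_scalar[OF G _ v, of "G\<^sup>T *\<^sub>v v"] G v
    by (simp add: assoc_mult_mat_vec[of _ n k _ n])
  then show "0 \<le> v \<bullet> ((G * G\<^sup>T) *\<^sub>v v)" by (simp add: scalar_prod_self_ge_0)
qed (use G in \<open>auto simp: transpose_mult[of _ n k _ n]\<close>)

text \<open>Testing on eigenvectors shows that no eigenvalue is negative, and a zero eigenvalue
  would put a nonzero vector in the kernel.\<close>

lemma psd_invertible_imp_spd:
  assumes A: "psd n A" and inv: "invertible_mat A"
  shows "spd n A"
proof -
  have Ac: "A \<in> carrier_mat n n" using A by (simp add: psd_def)
  obtain Q l where Q: "Q \<in> orthogonal_group n" and AQ: "A = conj_diag n Q l"
    using symmetric_diagonalization[of A n] A by (auto simp: psd_def)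
  obtain B where AB: "A * B = 1\<^sub>m n" and BA: "B * A = 1\<^sub>m (dim_row B)"
    using inv Ac by (auto simp: invertible_mat_def inverts_mat_def)
  \<comment> \<open>\<open>invertible_mat\<close> does not record the shape of \<open>B\<close>; it
    is read off the column counts of the two identities.\<close>
  have B: "B \<in> carrier_mat n n"
    using arg_cong[OF AB, of dim_col] arg_cong[OF BA, of dim_col] Ac by auto
  have "0 < l i" if i: "i < n" for i
  proof -
    note c = conj_diag_column[OF Q i]
    have "0 \<le> l i * ((Q *\<^sub>v unit_vec n i) \<bullet> (Q *\<^sub>v unit_vec n i))"
      using A c(1) by (auto simp: psd_def AQ dest!: bspec[OF _ c(1)] simp: c(3))
    then have "0 \<le> l i" using scalar_prod_self_pos[OF c(1,2)] by (simp add: zero_le_mult_iff)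
    moreover have "l i \<noteq> 0"
    proof
      assume l: "l i = 0"
      define w where "w = Q *\<^sub>v unit_vec n i"
      have w: "w \<in> carrier_vec n" "w \<noteq> 0\<^sub>v n" "A *\<^sub>v w = 0 \<cdot>\<^sub>v w"
        using c l unfolding w_def AQ by simp_all
      have "B *\<^sub>v (A *\<^sub>v w) = 0\<^sub>v n"
        unfolding w(3) using mult_mat_vec[OF B w(1), of 0] B by (auto intro: eq_vecI)
      then show False using w(1,2) BA B assoc_mult_mat_vec[OF B Ac w(1)] by simp
    qed
    ultimately show ?thesis by simp
  qed
  then show ?thesis unfolding AQ by (rule spd_conj_diag[OF Q])
qed

section \<open>Gradients under an orthogonal change of variables\<close>

lemma vec_norm2_smult: "vec_norm2 (c \<cdot>\<^sub>v v) = \<bar>c\<bar> * vec_norm2 v"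
  by (simp add: vec_norm2_def real_sqrt_mult mult.assoc[symmetric])

text \<open>Test both expansions along a small multiple \<open>v\<close> of
  \<open>w = g - h\<close>. Their linear parts differ by \<open>N\<close> times the length of
  \<open>v\<close>, while the two error bounds, with tolerance \<open>N / 4\<close> each, allow only
  half of that.\<close>

lemma has_gradient_unique:
  assumes g: "has_gradient n F g \<theta>" and h: "has_gradient n F h \<theta>"
  shows "g = h"
proof (rule ccontr)
  assume "g \<noteq> h"
  define w where "w = g - h"
  define N where "N = vec_norm2 w"
  have c: "g \<in> carrier_vec n" "h \<in> carrier_vec n" using g h by (auto simp: has_gradient_def)
  then have w: "w \<in> carrier_vec n" by (simp add: w_def)
  have "w \<noteq> 0\<^sub>v n"
  proof
    assume w0: "w = 0\<^sub>v n"
    have "g $ i = h $ i" if "i < n" for i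
      using arg_cong[OF w0, of "\<lambda>v. v $ i"] that c by (simp add: w_def)
    then show False using \<open>g \<noteq> h\<close> c by (metis eq_vecI carrier_vecD)
  qed
  then have ww: "0 < w \<bullet> w" using scalar_prod_self_pos[OF w] by simp
  then have N: "0 < N" "w \<bullet> w = N * N" by (simp_all add: N_def vec_norm2_def)
  have e: "0 < N / 4" using N by simp
  obtain r1 where r1: "0 < r1" "\<And>v. v \<in> carrier_vec n \<Longrightarrow> vec_norm2 v < r1 \<Longrightarrow>
      \<bar>F (\<theta> + v) - F \<theta> - g \<bullet> v\<bar> \<le> N / 4 * vec_norm2 v"
    using g e unfolding has_gradient_def by meson
  obtain r2 where r2: "0 < r2" "\<And>v. v \<in> carrier_vec n \<Longrightarrow> vec_norm2 v < r2 \<Longrightarrow>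
      \<bar>F (\<theta> + v) - F \<theta> - h \<bullet> v\<bar> \<le> N / 4 * vec_norm2 v"
    using h e unfolding has_gradient_def by meson
  \<comment> \<open>Chosen so that \<open>v\<close> has length \<open>min r1 r2 / 2\<close>, inside
    both radii.\<close>
  define s where "s = min r1 r2 / (2 * N)"
  have s: "0 < s" using r1 r2 N by (simp add: s_def)
  define v where "v = s \<cdot>\<^sub>v w"
  have v: "v \<in> carrier_vec n" using w by (simp add: v_def)
  have nv: "vec_norm2 v = s * N" using s by (simp add: v_def vec_norm2_smult N_def)
  then have "vec_norm2 v < r1" "vec_norm2 v < r2" using r1(1) r2(1) N by (auto simp: s_def)
  then have "\<bar>F (\<theta> + v) - F \<theta> - g \<bullet> v\<bar> \<le> N / 4 * (s * N)"
    "\<bar>F (\<theta> + v) - F \<theta> - h \<bullet> v\<bar> \<le> N / 4 * (s * N)"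
    using r1(2)[OF v] r2(2)[OF v] unfolding nv by simp_all
  then have "\<bar>g \<bullet> v - h \<bullet> v\<bar> \<le> N / 4 * (s * N) + N / 4 * (s * N)" by linarith
  moreover have "g \<bullet> v - h \<bullet> v = s * (N * N)"
    using c w N(2) minus_scalar_prod_distrib[OF c w]
    by (simp add: v_def w_def[symmetric] right_diff_distrib[symmetric])
  ultimately have "s * (N * N) \<le> s * (N * N) / 2" by (simp add: algebra_simps)
  then show False using s N by simp
qed

lemma gradient_eqI: "has_gradient n F g \<theta> \<Longrightarrow> gradient n F \<theta> = g"
  unfolding gradient_def using has_gradient_unique by blast

text \<open>Chain rule for a linear isometry: \<open>Q\<close> preserves lengths, so the radius
  found for \<open>F\<close> serves \<open>G\<close> as well, and it crosses the inner product as
  its transpose.\<close>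

lemma has_gradient_orthogonal:
  assumes Q: "Q \<in> orthogonal_group n" and \<theta>: "\<theta> \<in> carrier_vec n"
    and FG: "\<And>x. x \<in> carrier_vec n \<Longrightarrow> G x = F (Q *\<^sub>v x)"
    and g: "has_gradient n F g (Q *\<^sub>v \<theta>)"
  shows "has_gradient n G (Q\<^sup>T *\<^sub>v g) \<theta>"
  unfolding has_gradient_def
proof (intro conjI allI impI)
  note Qc = orthogonal_groupD(1,2)[OF Q]
  have gc: "g \<in> carrier_vec n" using g by (simp add: has_gradient_def)
  then show "Q\<^sup>T *\<^sub>v g \<in> carrier_vec n" using Qc by simp
  fix e :: real assume "0 < e"
  then obtain r where r: "0 < r" "\<And>v. v \<in> carrier_vec n \<Longrightarrow> vec_norm2 v < r \<Longrightarrow>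
      \<bar>F (Q *\<^sub>v \<theta> + v) - F (Q *\<^sub>v \<theta>) - g \<bullet> v\<bar> \<le> e * vec_norm2 v"
    using g unfolding has_gradient_def by meson
  show "\<exists>r>0. \<forall>v \<in> carrier_vec n. vec_norm2 v < r \<longrightarrow>
        \<bar>G (\<theta> + v) - G \<theta> - (Q\<^sup>T *\<^sub>v g) \<bullet> v\<bar> \<le> e * vec_norm2 v"
  proof (intro exI[of _ r] conjI ballI impI)
    fix v :: "real vec" assume v: "v \<in> carrier_vec n" and nv: "vec_norm2 v < r"
    have Qv: "Q *\<^sub>v v \<in> carrier_vec n" using Qc v by simp
    have "(Q *\<^sub>v v) \<bullet> (Q *\<^sub>v v) = v \<bullet> v"
      using transpose_vec_mult_scalar[OF Qc(1) v Qv] orthogonal_cancel_vec(1)[OF Q v] by simp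
    then have "vec_norm2 (Q *\<^sub>v v) = vec_norm2 v" by (simp add: vec_norm2_def)
    moreover have "Q *\<^sub>v (\<theta> + v) = Q *\<^sub>v \<theta> + Q *\<^sub>v v"
      using mult_add_distrib_mat_vec[OF Qc(1) \<theta> v] .
    ultimately show "\<bar>G (\<theta> + v) - G \<theta> - (Q\<^sup>T *\<^sub>v g) \<bullet> v\<bar> \<le> e * vec_norm2 v"
      using r(2)[OF Qv] nv \<theta> v transpose_vec_mult_scalar[OF Qc(1) v gc] by (simp add: FG)
  qed (rule r(1))
qed

section \<open>The lifted rotation acting on parameters\<close>

lemma weight_carrier: "weight m j \<theta> \<in> carrier_mat (m j) (m (j - 1))"
  by (simp add: weight_def)

lemma bias_carrier: "bias m L j \<theta> \<in> carrier_vec (m j)"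
  by (simp add: bias_def)

lemma pack_cong:
  assumes "\<And>j. 1 \<le> j \<Longrightarrow> j \<le> L + 1 \<Longrightarrow> W j = W' j" "\<And>j. 1 \<le> j \<Longrightarrow> j \<le> L + 1 \<Longrightarrow> b j = b' j"
  shows "pack L W b = pack L W' b'"
proof -
  have "map (\<lambda>j. flatten_mat (W j)) [1..<L + 2] = map (\<lambda>j. flatten_mat (W' j)) [1..<L + 2]"
    "map (\<lambda>j. list_of_vec (b j)) [1..<L + 2] = map (\<lambda>j. list_of_vec (b' j)) [1..<L + 2]"
    using assms by (auto simp del: upt_Suc)
  then show ?thesis by (simp only: pack_def)
qed

text \<open>Reduces an equation between parameter vectors to one equation per weight matrix and
  bias, which keeps the index arithmetic of \<open>pack\<close> out of later proofs.\<close>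

lemma params_eqI:
  assumes "\<theta> \<in> carrier_vec (num_params m L)" "\<theta>' \<in> carrier_vec (num_params m L)"
    and "\<And>j. 1 \<le> j \<Longrightarrow> j \<le> L + 1 \<Longrightarrow> weight m j \<theta> = weight m j \<theta>'"
    and "\<And>j. 1 \<le> j \<Longrightarrow> j \<le> L + 1 \<Longrightarrow> bias m L j \<theta> = bias m L j \<theta>'"
  shows "\<theta> = \<theta>'"
proof -
  have "pack L (\<lambda>j. weight m j \<theta>) (\<lambda>j. bias m L j \<theta>) =
      pack L (\<lambda>j. weight m j \<theta>') (\<lambda>j. bias m L j \<theta>')"
    by (rule pack_cong) (fact assms(3,4))+
  then show ?thesis unfolding pack_weight_bias[OF assms(1)] pack_weight_bias[OF assms(2)] .
qed

lemma first_block_le: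
  fixes m :: "nat \<Rightarrow> nat"
  shows "m 1 * m 0 \<le> (\<Sum>i = 1..L + 1. m i * m (i - 1))"
  using member_le_sum[of 1 "{1..L + 1}" "\<lambda>i. m i * m (i - 1)"] by simp

lemma first_block_le_num_params: "m 1 * m 0 \<le> num_params m L"
  unfolding num_params_def using first_block_le[of m L] by linarith

section \<open>Entries of the lifted rotation\<close>

lemma kronecker_carrier:
  "A \<in> carrier_mat a b \<Longrightarrow> B \<in> carrier_mat c d \<Longrightarrow> kronecker A B \<in> carrier_mat (a * c) (b * d)"
  by (auto simp: kronecker_def)

lemma kronecker_transpose: "(kronecker A B)\<^sup>T = kronecker (A\<^sup>T) (B\<^sup>T)"
proof (rule eq_matI)
  fix i j assume "i < dim_row (kronecker (A\<^sup>T) (B\<^sup>T))" "j < dim_col (kronecker (A\<^sup>T) (B\<^sup>T))"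
  then have i: "i < dim_col A * dim_col B" and j: "j < dim_row A * dim_row B"
    by (simp_all add: kronecker_def)
  then have "i div dim_col B < dim_col A" "j div dim_row B < dim_row A"
    by (simp_all add: less_mult_imp_div_less)
  moreover have "i mod dim_col B < dim_col B" "j mod dim_row B < dim_row B"
    using i j by (auto intro!: mod_less_divisor Nat.gr0I)
  ultimately show "(kronecker A B)\<^sup>T $$ (i, j) = kronecker (A\<^sup>T) (B\<^sup>T) $$ (i, j)"
    using i j by (simp add: kronecker_def)
qed (simp_all add: kronecker_def)

lemma lifted_rotation_transpose:
  assumes "U \<in> carrier_mat (m 0) (m 0)"
  shows "(lifted_rotation m L U)\<^sup>T = lifted_rotation m L (U\<^sup>T)"
proof -
  have "kronecker (U\<^sup>T) (1\<^sub>m (m 1)) \<in> carrier_mat (m 1 * m 0) (m 1 * m 0)"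
    using kronecker_carrier[of "U\<^sup>T" "m 0" "m 0" "1\<^sub>m (m 1)" "m 1" "m 1"] assms
    by (simp add: mult.commute)
  then show ?thesis
    unfolding lifted_rotation_def Let_def
    by (subst transpose_four_block_mat[of _ "m 1 * m 0" "m 1 * m 0" _ "num_params m L - m 1 * m 0"
          _ "num_params m L - m 1 * m 0"])
      (simp_all add: kronecker_transpose)
qed

lemma lifted_rotation_carrier:
  assumes "U \<in> carrier_mat (m 0) (m 0)"
  shows "lifted_rotation m L U \<in> carrier_mat (num_params m L) (num_params m L)"
proof -
  have "kronecker (U\<^sup>T) (1\<^sub>m (m 1)) \<in> carrier_mat (m 1 * m 0) (m 1 * m 0)"
    using kronecker_carrier[of "U\<^sup>T" "m 0" "m 0" "1\<^sub>m (m 1)" "m 1" "m 1"] assms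
    by (simp add: mult.commute)
  then show ?thesis
    unfolding lifted_rotation_def Let_def
    using first_block_le_num_params[of m L] by (auto intro!: carrier_matI)
qed

text \<open>Position \<open>k\<close> in the first block encodes row \<open>k mod m 1\<close> and
  column \<open>k div m 1\<close> of the first weight matrix; the factor
  \<open>1\<^sub>m (m 1)\<close> of the Kronecker product couples only positions in the same
  row.\<close>

lemma lifted_rotation_index:
  assumes U: "U \<in> carrier_mat (m 0) (m 0)" and k: "k < num_params m L" "l < num_params m L"
  shows "lifted_rotation m L U $$ (k, l) =
    (if k < m 1 * m 0 \<and> l < m 1 * m 0
     then (if k mod m 1 = l mod m 1 then U $$ (l div m 1, k div m 1) else 0)
     else if k = l then 1 else 0)"
proof -
  define q K where "q = m 1 * m 0" and "K = kronecker (U\<^sup>T) (1\<^sub>m (m 1))"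
  have dim: "dim_row K = q" "dim_col K = q" using U by (simp_all add: q_def K_def kronecker_def)
  have "K $$ (k, l) = (if k mod m 1 = l mod m 1 then U $$ (l div m 1, k div m 1) else 0)"
    if "k < q" "l < q"
  proof -
    have kl: "k < m 0 * m 1" "l < m 0 * m 1" using that by (simp_all add: q_def mult.commute)
    then have "k div m 1 < m 0" "l div m 1 < m 0" by (simp_all add: less_mult_imp_div_less)
    moreover have "k mod m 1 < m 1" "l mod m 1 < m 1"
      using kl by (auto intro!: mod_less_divisor Nat.gr0I)
    ultimately show ?thesis using U kl by (simp add: K_def kronecker_def)
  qed
  moreover have "lifted_rotation m L U =
      four_block_mat K (0\<^sub>m q (num_params m L - q)) (0\<^sub>m (num_params m L - q) q) (1\<^sub>m (num_params m L - q))"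
    by (simp only: lifted_rotation_def Let_def q_def K_def)
  ultimately show ?thesis
    using k first_block_le_num_params[of m L] unfolding q_def[symmetric]
    by (cases "k < q"; cases "l < q") (auto simp: dim)
qed

lemma lifted_rotation_mult_vec_outside:
  assumes U: "U \<in> carrier_mat (m 0) (m 0)" and \<theta>: "\<theta> \<in> carrier_vec (num_params m L)"
    and k: "m 1 * m 0 \<le> k" "k < num_params m L"
  shows "(lifted_rotation m L U *\<^sub>v \<theta>) $ k = \<theta> $ k"
proof -
  let ?p = "num_params m L"
  have "(lifted_rotation m L U *\<^sub>v \<theta>) $ k = (\<Sum>l = 0..<?p. lifted_rotation m L U $$ (k, l) * \<theta> $ l)"
    using lifted_rotation_carrier[where m = m, OF U, of L] \<theta> k by (simp add: scalar_prod_def)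
  also have "\<dots> = (\<Sum>l = 0..<?p. if l = k then \<theta> $ k else 0)"
    by (rule sum.cong) (use k in \<open>auto simp: lifted_rotation_index[where m = m, OF U]\<close>)
  finally show ?thesis using k by (simp add: sum.delta)
qed

text \<open>Since \<open>c * m 1 + r\<close> is the column-major position of entry
  \<open>(r, c)\<close>, the right-hand side is that entry of the first weight matrix times
  \<open>U\<close>.\<close>

lemma lifted_rotation_mult_vec_inside:
  assumes U: "U \<in> carrier_mat (m 0) (m 0)" and \<theta>: "\<theta> \<in> carrier_vec (num_params m L)"
    and r: "r < m 1" and c: "c < m 0"
  shows "(lifted_rotation m L U *\<^sub>v \<theta>) $ (c * m 1 + r) =
    (\<Sum>i = 0..<m 0. \<theta> $ (i * m 1 + r) * U $$ (i, c))"
proof -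
  let ?p = "num_params m L" and ?q = "m 1 * m 0" and ?k = "c * m 1 + r"
  let ?f = "\<lambda>l. (if l mod m 1 = r then U $$ (l div m 1, c) else 0) * \<theta> $ l"
  have k: "?k < ?q" using index_bound[OF r c] .
  have qp: "?q \<le> ?p" by (rule first_block_le_num_params)
  have "(lifted_rotation m L U *\<^sub>v \<theta>) $ ?k = (\<Sum>l = 0..<?p. lifted_rotation m L U $$ (?k, l) * \<theta> $ l)"
    using lifted_rotation_carrier[where m = m, OF U, of L] \<theta> k qp by (simp add: scalar_prod_def)
  also have "\<dots> = (\<Sum>l = 0..<?p. if l < ?q then ?f l else 0)"
    by (rule sum.cong) (use k r qp in \<open>auto simp: lifted_rotation_index[where m = m, OF U]\<close>)
  also have "\<dots> = sum ?f {0..<?q}"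
    using qp by (simp add: sum.If_cases) (rule sum.cong, auto)
  also have "\<dots> = sum ?f ((\<lambda>i. i * m 1 + r) ` {0..<m 0})"
  proof (rule sum.mono_neutral_right)
    show "(\<lambda>i. i * m 1 + r) ` {0..<m 0} \<subseteq> {0..<?q}" using index_bound[OF r] by auto
    show "\<forall>l \<in> {0..<?q} - (\<lambda>i. i * m 1 + r) ` {0..<m 0}. ?f l = 0"
    proof
      fix l assume l: "l \<in> {0..<?q} - (\<lambda>i. i * m 1 + r) ` {0..<m 0}"
      have "l mod m 1 \<noteq> r"
      proof
        assume "l mod m 1 = r"
        then have "l = (l div m 1) * m 1 + r" by (metis div_mult_mod_eq)
        moreover have "l div m 1 < m 0" using l by (auto simp: less_mult_imp_div_less mult.commute)
        ultimately show False using l by auto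
      qed
      then show "?f l = 0" by simp
    qed
  qed simp
  \<comment> \<open>Distinct columns give distinct positions because \<open>r < m 1\<close> forces
    \<open>m 1\<close> to be positive.\<close>
  also have "\<dots> = (\<Sum>i = 0..<m 0. ?f (i * m 1 + r))"
    using r by (subst sum.reindex) (auto simp: inj_on_def)
  also have "\<dots> = (\<Sum>i = 0..<m 0. \<theta> $ (i * m 1 + r) * U $$ (i, c))"
    using r by (intro sum.cong) auto
  finally show ?thesis .
qed

text \<open>The right factor that the rotation contributes to the weights of layer \<open>j\<close>.
  Taking the identity beyond the first layer lets all layers be treated by the same
  formulas.\<close>

definition layer_rotation :: "(nat \<Rightarrow> nat) \<Rightarrow> real mat \<Rightarrow> nat \<Rightarrow> real mat" where
  "layer_rotation m U j = (if j = 1 then U else 1\<^sub>m (m (j - 1)))"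

lemma layer_rotation_carrier:
  "U \<in> carrier_mat (m 0) (m 0) \<Longrightarrow> layer_rotation m U j \<in> carrier_mat (m (j - 1)) (m (j - 1))"
  by (auto simp: layer_rotation_def)

lemma layer_rotation_orthogonal:
  "U \<in> orthogonal_group (m 0) \<Longrightarrow> layer_rotation m U j \<in> orthogonal_group (m (j - 1))"
  by (auto simp: layer_rotation_def orthogonal_group_def)

lemma layer_rotation_transpose: "layer_rotation m (U\<^sup>T) j = (layer_rotation m U j)\<^sup>T"
  by (simp add: layer_rotation_def)

text \<open>This is the identity \<open>vec (W U) = (U\<^sup>T \<otimes> I) vec W\<close> for column-major vectorization.\<close>

lemma weight_lifted_rotation:
  assumes U: "U \<in> carrier_mat (m 0) (m 0)" and \<theta>: "\<theta> \<in> carrier_vec (num_params m L)"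
    and j: "1 \<le> j" "j \<le> L + 1"
  shows "weight m j (lifted_rotation m L U *\<^sub>v \<theta>) = weight m j \<theta> * layer_rotation m U j"
proof (cases "j = 1")
  case True
  show ?thesis
  proof (rule eq_matI)
    fix r c assume "r < dim_row (weight m j \<theta> * layer_rotation m U j)"
      "c < dim_col (weight m j \<theta> * layer_rotation m U j)"
    then have r: "r < m 1" and c: "c < m 0" using True U by (auto simp: weight_def layer_rotation_def)
    show "weight m j (lifted_rotation m L U *\<^sub>v \<theta>) $$ (r, c) =
        (weight m j \<theta> * layer_rotation m U j) $$ (r, c)"
      using lifted_rotation_mult_vec_inside[OF U \<theta> r c] True r c U
      by (simp add: weight_def layer_rotation_def scalar_prod_def)
  qed (use True U in \<open>auto simp: weight_def layer_rotation_def\<close>)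
next
  case False
  have "weight m j (lifted_rotation m L U *\<^sub>v \<theta>) = weight m j \<theta>"
  proof (rule eq_matI)
    fix r c assume "r < dim_row (weight m j \<theta>)" "c < dim_col (weight m j \<theta>)"
    then have rc: "r < m j" "c < m (j - 1)" by (simp_all add: weight_def)
    let ?s = "\<Sum>i = 1..<j. m i * m (i - 1)"
    \<comment> \<open>The offset of a later layer already contains the first block, so its entries
      lie where the lifted rotation is the identity.\<close>
    have "m 1 * m 0 \<le> ?s"
      using member_le_sum[of 1 "{1..<j}" "\<lambda>i. m i * m (i - 1)"] j False by simp
    moreover have "?s + (c * m j + r) < num_params m L"
      unfolding num_params_def
      using sum_block_bound[OF j, of "c * m j + r" "\<lambda>i. m i * m (i - 1)"] index_bound[OF rc]
      by linarith
    ultimately have "(lifted_rotation m L U *\<^sub>v \<theta>) $ (?s + (c * m j + r)) = \<theta> $ (?s + (c * m j + r))"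
      by (intro lifted_rotation_mult_vec_outside[OF U \<theta>]) auto
    then show "weight m j (lifted_rotation m L U *\<^sub>v \<theta>) $$ (r, c) = weight m j \<theta> $$ (r, c)"
      using rc by (simp add: weight_def)
  qed (auto simp: weight_def)
  then show ?thesis
    using False right_mult_one_mat[OF weight_carrier[of m j \<theta>]] by (simp add: layer_rotation_def)
qed

lemma bias_lifted_rotation:
  assumes U: "U \<in> carrier_mat (m 0) (m 0)" and \<theta>: "\<theta> \<in> carrier_vec (num_params m L)"
    and j: "1 \<le> j" "j \<le> L + 1"
  shows "bias m L j (lifted_rotation m L U *\<^sub>v \<theta>) = bias m L j \<theta>"
proof (rule eq_vecI)
  fix r assume "r < dim_vec (bias m L j \<theta>)"
  then have r: "r < m j" by (simp add: bias_def)
  let ?s = "\<Sum>i = 1..L + 1. m i * m (i - 1)" and ?t = "\<Sum>i = 1..<j. m i"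
  have "?s + (?t + r) < num_params m L"
    unfolding num_params_def using sum_block_bound[of j L r m] j r by simp
  moreover have "m 1 * m 0 \<le> ?s + (?t + r)" using first_block_le[of m L] by linarith
  ultimately have "(lifted_rotation m L U *\<^sub>v \<theta>) $ (?s + (?t + r)) = \<theta> $ (?s + (?t + r))"
    by (intro lifted_rotation_mult_vec_outside[OF U \<theta>]) auto
  then show "bias m L j (lifted_rotation m L U *\<^sub>v \<theta>) $ r = bias m L j \<theta> $ r"
    unfolding bias_def using r by (simp only: index_vec)
qed (simp add: bias_def)

lemma lifted_rotation_mult_vec_carrier:
  "U \<in> carrier_mat (m 0) (m 0) \<Longrightarrow> \<theta> \<in> carrier_vec (num_params m L) \<Longrightarrow>
    lifted_rotation m L U *\<^sub>v \<theta> \<in> carrier_vec (num_params m L)"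
  using lifted_rotation_carrier[of U m L] by simp

text \<open>Checked on unit vectors, layer by layer. Rotations act on weights from the right, so
  applying \<open>V\<close> first and \<open>U\<close> second multiplies by \<open>V * U\<close>:
  the order is reversed.\<close>

lemma lifted_rotation_inverse:
  assumes U: "U \<in> carrier_mat (m 0) (m 0)" and V: "V \<in> carrier_mat (m 0) (m 0)"
    and VU: "V * U = 1\<^sub>m (m 0)"
  shows "lifted_rotation m L U * lifted_rotation m L V = 1\<^sub>m (num_params m L)"
proof (rule eq_matI)
  let ?p = "num_params m L" and ?A = "lifted_rotation m L U" and ?B = "lifted_rotation m L V"
  note A = lifted_rotation_carrier[where m = m, OF U, of L] and B = lifted_rotation_carrier[where m = m, OF V, of L]
  fix k l assume "k < dim_row (1\<^sub>m ?p :: real mat)" "l < dim_col (1\<^sub>m ?p :: real mat)"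
  then have kl: "k < ?p" "l < ?p" by simp_all
  define e where "e = (unit_vec ?p l :: real vec)"
  have e: "e \<in> carrier_vec ?p" by (simp add: e_def)
  note Be = lifted_rotation_mult_vec_carrier[where m = m, OF V e]
  have "?A *\<^sub>v (?B *\<^sub>v e) = e"
  proof (rule params_eqI[OF lifted_rotation_mult_vec_carrier[where m = m, OF U Be] e])
    fix j assume j: "1 \<le> j" "j \<le> L + 1"
    have "layer_rotation m V j * layer_rotation m U j = 1\<^sub>m (m (j - 1))"
      by (simp add: layer_rotation_def VU)
    then show "weight m j (?A *\<^sub>v (?B *\<^sub>v e)) = weight m j e"
      using weight_carrier[of m j e] layer_rotation_carrier[where m = m, OF U, of j] layer_rotation_carrier[where m = m, OF V, of j]
      by (simp add: weight_lifted_rotation[OF U Be j] weight_lifted_rotation[OF V e j]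
          assoc_mult_mat[of _ "m j" "m (j - 1)" _ "m (j - 1)" _ "m (j - 1)"])
    show "bias m L j (?A *\<^sub>v (?B *\<^sub>v e)) = bias m L j e"
      by (simp add: bias_lifted_rotation[OF U Be j] bias_lifted_rotation[OF V e j])
  qed
  then have ABe: "(?A * ?B) *\<^sub>v e = e" using assoc_mult_mat_vec[OF A B e] by simp
  have "X $$ (k, l) = (X *\<^sub>v e) $ k" if "X \<in> carrier_mat ?p ?p" for X
    using that kl by (simp add: e_def)
  from this[OF mult_carrier_mat[OF A B]] show "(?A * ?B) $$ (k, l) = 1\<^sub>m ?p $$ (k, l)"
    unfolding ABe using kl by (simp add: e_def)
qed (use lifted_rotation_carrier[where m = m, OF U, of L] lifted_rotation_carrier[where m = m, OF V, of L] in auto)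

lemma lifted_rotation_orthogonal:
  assumes "U \<in> orthogonal_group (m 0)"
  shows "lifted_rotation m L U \<in> orthogonal_group (num_params m L)"
  using orthogonal_groupD[OF assms] lifted_rotation_inverse[of U m "U\<^sup>T" L]
    lifted_rotation_inverse[of "U\<^sup>T" m U L] lifted_rotation_carrier[of U m L]
  by (simp add: orthogonal_group_def lifted_rotation_transpose)

section \<open>The forward pass with rotated parameters\<close>

lemma hidden_lifted_rotation:
  assumes U: "U \<in> carrier_mat (m 0) (m 0)" and \<theta>: "\<theta> \<in> carrier_vec (num_params m L)"
    and x: "x \<in> carrier_vec (m 0)" and j: "1 \<le> j" "j \<le> L"
  shows "hidden m L \<sigma> (lifted_rotation m L U *\<^sub>v \<theta>) x (Suc j) = hidden m L \<sigma> \<theta> (U *\<^sub>v x) (Suc j)"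
  using j
proof (induction j rule: dec_induct)
  \<comment> \<open>The claim starts at layer index 2, since at index 1 the two sides are
    \<open>x\<close> and \<open>U x\<close>. Associativity, \<open>(W U) x = W (U x)\<close>, moves
    the rotation from the weights to the input.\<close>
  case base
  have "weight m 1 \<theta> * U *\<^sub>v x = weight m 1 \<theta> *\<^sub>v (U *\<^sub>v x)"
    using assoc_mult_mat_vec[OF _ U x] weight_carrier[of m 1 \<theta>] by simp
  then show ?case
    using base weight_lifted_rotation[OF U \<theta>, of 1] bias_lifted_rotation[OF U \<theta>, of 1]
    by (simp add: layer_rotation_def)
next
  case (step j)
  then show ?case
    using weight_lifted_rotation[OF U \<theta>, of "Suc j"] bias_lifted_rotation[OF U \<theta>, of "Suc j"]
      right_mult_one_mat[OF weight_carrier[of m "Suc j" \<theta>]]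
    by (simp add: layer_rotation_def)
qed

text \<open>As \<open>1 \<le> L\<close>, the output layer is not the first one, so its weights are
  untouched by the rotation.\<close>

lemma network_lifted_rotation:
  assumes U: "U \<in> carrier_mat (m 0) (m 0)" and \<theta>: "\<theta> \<in> carrier_vec (num_params m L)"
    and x: "x \<in> carrier_vec (m 0)" and L: "1 \<le> L"
  shows "network m L \<sigma> (lifted_rotation m L U *\<^sub>v \<theta>) x = network m L \<sigma> \<theta> (U *\<^sub>v x)"
  using hidden_lifted_rotation[OF U \<theta> x L order_refl, of \<sigma>] L
    weight_lifted_rotation[OF U \<theta>, of "L + 1"] bias_lifted_rotation[OF U \<theta>, of "L + 1"]
    right_mult_one_mat[OF weight_carrier[of m "L + 1" \<theta>]]
  by (simp add: network_def layer_rotation_def del: hidden.simps)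

section \<open>The rotated objective\<close>

lemma space_borel_vec: "space (borel_vec d) = carrier_vec d"
  by (simp add: borel_vec_def)

lemma measurable_vec_index:
  assumes "k < d"
  shows "(\<lambda>v. v $ k) \<in> borel_measurable (borel_vec d)"
proof -
  have "(\<lambda>v. \<lambda>i\<in>{..<d}. v $ i) \<in> borel_vec d \<rightarrow>\<^sub>M (\<Pi>\<^sub>M i\<in>{..<d}. borel)"
    unfolding borel_vec_def by (rule measurable_vimage_algebra1) (auto simp: space_PiM)
  from measurable_compose[OF this measurable_component_singleton[of k]] assms show ?thesis by simp
qed

text \<open>Each coordinate of \<open>U v\<close> is a finite linear combination of coordinates of
  \<open>v\<close>, and the sigma-algebra is generated by the coordinates.\<close>

lemma measurable_mult_mat_vec:
  assumes U: "U \<in> carrier_mat d d"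
  shows "(\<lambda>v. U *\<^sub>v v) \<in> borel_vec d \<rightarrow>\<^sub>M borel_vec d"
proof -
  have "(\<lambda>v. (U *\<^sub>v v) $ i) \<in> borel_measurable (borel_vec d)" if "i < d" for i
  proof -
    have "(\<lambda>v. \<Sum>k = 0..<d. U $$ (i, k) * v $ k) \<in> borel_measurable (borel_vec d)"
      by (intro borel_measurable_sum borel_measurable_times borel_measurable_const measurable_vec_index)
        simp
    then show ?thesis
      by (rule measurable_cong[THEN iffD1, rotated])
        (use U that in \<open>auto simp: space_borel_vec scalar_prod_def\<close>)
  qed
  then have "(\<lambda>v. \<lambda>i\<in>{..<d}. (U *\<^sub>v v) $ i) \<in> borel_vec d \<rightarrow>\<^sub>M (\<Pi>\<^sub>M i\<in>{..<d}. borel)"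
    by (intro measurable_restrict) auto
  then show ?thesis
    \<comment> \<open>This instance unfolds \<open>borel_vec\<close> in the target only, leaving the
      source as it stands in the fact just proved.\<close>
    unfolding borel_vec_def[of d, THEN arg_cong[of _ _ "measurable (borel_vec d)"]]
    by (intro measurable_vimage_algebra2) (use U in \<open>auto simp: space_borel_vec\<close>)
qed

text \<open>Change of variables for the image measure, after which
  \<open>network_lifted_rotation\<close> moves \<open>U\<close> from the input into the
  parameters.\<close>

lemma expected_loss_rotated_data:
  assumes D: "data_distribution (m 0) D" and U: "U \<in> carrier_mat (m 0) (m 0)" and L: "1 \<le> L"
    and \<theta>: "\<theta> \<in> carrier_vec (num_params m L)"
    and int: "integrable D (\<lambda>(x, y). loss y (network m L \<sigma> \<theta> x))"
  shows "expected_loss (rotated_data (m 0) U D) loss (network m L \<sigma>) \<theta> =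
    expected_loss D loss (network m L \<sigma>) (lifted_rotation m L U *\<^sub>v \<theta>)"
proof -
  let ?N = "borel_vec (m 0) \<Otimes>\<^sub>M (borel :: real measure)"
  have sets: "sets D = sets ?N" using D by (simp add: data_distribution_def)
  then have space: "space D = carrier_vec (m 0) \<times> UNIV"
    by (simp add: sets_eq_imp_space_eq[OF sets] space_pair_measure space_borel_vec)
  have "(\<lambda>z. (U *\<^sub>v fst z, snd z)) \<in> ?N \<rightarrow>\<^sub>M ?N"
    using measurable_compose[OF measurable_fst measurable_mult_mat_vec[OF U]] by measurable
  then have T: "(\<lambda>(x, y). (U *\<^sub>v x, y)) \<in> D \<rightarrow>\<^sub>M ?N"
    by (simp add: case_prod_beta measurable_cong_sets[OF sets refl])
  \<comment> \<open>Integrability provides the measurability of the integrand that the change of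
    variables requires.\<close>
  have "(\<lambda>(x, y). loss y (network m L \<sigma> \<theta> x)) \<in> borel_measurable D"
    using int by (rule borel_measurable_integrable)
  then have g: "(\<lambda>(x, y). loss y (network m L \<sigma> \<theta> x)) \<in> borel_measurable ?N"
    by (simp add: measurable_cong_sets[OF sets refl])
  show ?thesis
    unfolding expected_loss_def rotated_data_def integral_distr[OF T g]
    by (rule Bochner_Integration.integral_cong)
      (auto simp: space network_lifted_rotation[OF U \<theta> _ L])
qed

section \<open>Equivariance of the iteration\<close>

text \<open>The \<open>V\<^sup>T\<close> ending the rotated gradient meets the \<open>V\<close>
  starting the conjugated root and cancels, so a single \<open>V\<^sup>T\<close> remains at the
  right end and factors out of the whole update.\<close>

lemma shampoo_update_rotation:
  assumes V: "V \<in> orthogonal_group c" and W: "W \<in> carrier_mat r c" and G: "G \<in> carrier_mat r c"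
    and A: "A \<in> carrier_mat r r" and B: "spd c B"
  shows "W * V\<^sup>T - \<eta> \<cdot>\<^sub>m (A * (G * V\<^sup>T) * inv_fourth_root (V * B * V\<^sup>T)) =
    (W - \<eta> \<cdot>\<^sub>m (A * G * inv_fourth_root B)) * V\<^sup>T"
proof -
  let ?R = "inv_fourth_root B"
  note Vc = orthogonal_groupD(1,2)[OF V]
  have R: "?R \<in> carrier_mat c c" using spdD(1)[OF inv_fourth_root_spd(1)[OF B]] .
  have AG: "A * G \<in> carrier_mat r c" using A G by simp
  have AGR: "A * G * ?R \<in> carrier_mat r c" using AG R by simp
  have RV: "?R * V\<^sup>T \<in> carrier_mat c c" using R Vc by simp
  have "A * (G * V\<^sup>T) * (V * ?R * V\<^sup>T) = (A * G) * (V\<^sup>T * (V * (?R * V\<^sup>T)))"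
    using Vc R A G AG RV
    by (simp add: assoc_mult_mat[of _ r c _ c _ c] assoc_mult_mat[of _ c c _ c _ c]
        assoc_mult_mat[of _ r r _ c _ c])
  also have "\<dots> = A * G * ?R * V\<^sup>T"
    unfolding orthogonal_cancel(1)[OF V RV] using assoc_mult_mat[OF AG R Vc(2)] by simp
  finally have "A * (G * V\<^sup>T) * inv_fourth_root (V * B * V\<^sup>T) = A * G * ?R * V\<^sup>T"
    by (simp add: inv_fourth_root_conjugate[OF V B])
  then show ?thesis
    using mult_smult_assoc_mat[OF AGR Vc(2)] minus_mult_distrib_mat[OF W _ Vc(2)] AGR by simp
qed

text \<open>In the left statistic the two rotations meet and cancel; in the right one they stay
  outside and merge with the conjugation of \<open>R\<close>.\<close>

lemma gram_rotation:
  assumes V: "V \<in> orthogonal_group c" and G: "G \<in> carrier_mat r c" and R: "R \<in> carrier_mat c c"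
  shows "(G * V\<^sup>T) * (G * V\<^sup>T)\<^sup>T = G * G\<^sup>T"
    and "V * R * V\<^sup>T + (G * V\<^sup>T)\<^sup>T * (G * V\<^sup>T) = V * (R + G\<^sup>T * G) * V\<^sup>T"
proof -
  note Vc = orthogonal_groupD(1,2)[OF V]
  have GT: "G\<^sup>T \<in> carrier_mat c r" using G by simp
  have T: "(G * V\<^sup>T)\<^sup>T = V * G\<^sup>T" using transpose_mult[OF G Vc(2)] by simp
  have "(G * V\<^sup>T) * (V * G\<^sup>T) = G * (V\<^sup>T * (V * G\<^sup>T))"
    by (rule assoc_mult_mat) (use G Vc GT in auto)
  then show "(G * V\<^sup>T) * (G * V\<^sup>T)\<^sup>T = G * G\<^sup>T"
    unfolding T orthogonal_cancel(1)[OF V GT] .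
  have GG: "G\<^sup>T * G \<in> carrier_mat c c" using G by simp
  have "(V * G\<^sup>T) * (G * V\<^sup>T) = V * (G\<^sup>T * (G * V\<^sup>T))"
    by (rule assoc_mult_mat) (use G Vc GT in auto)
  also have "G\<^sup>T * (G * V\<^sup>T) = G\<^sup>T * G * V\<^sup>T" using assoc_mult_mat[OF GT G Vc(2)] by simp
  also have "V * (G\<^sup>T * G * V\<^sup>T) = V * (G\<^sup>T * G) * V\<^sup>T" using assoc_mult_mat[OF Vc(1) GG Vc(2)] by simp
  finally have "(V * G\<^sup>T) * (G * V\<^sup>T) = V * (G\<^sup>T * G) * V\<^sup>T" .
  then show "V * R * V\<^sup>T + (G * V\<^sup>T)\<^sup>T * (G * V\<^sup>T) = V * (R + G\<^sup>T * G) * V\<^sup>T"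
    unfolding T mult_add_distrib_mat[OF Vc(1) R GG]
    using add_mult_distrib_mat[of "V * R" c c "V * (G\<^sup>T * G)" "V\<^sup>T" c] Vc R GG by simp
qed

text \<open>The iterates alone do not form an inductive invariant, so the preconditioners of both
  runs are carried along. Semidefiniteness is included because, together with invertibility, it
  makes the inverse roots well defined.\<close>

lemma shampoo_state_equivariant:
  fixes m :: "nat \<Rightarrow> nat" and L :: nat and F FU :: "real vec \<Rightarrow> real"
  defines "p \<equiv> num_params m L"
  assumes U: "U \<in> orthogonal_group (m 0)" and \<epsilon>: "0 \<le> \<epsilon>" and \<theta>0: "\<theta>0 \<in> carrier_vec p"
    and diff: "\<And>\<theta>. \<theta> \<in> carrier_vec p \<Longrightarrow> vec_differentiable p F \<theta>"
    and FU: "\<And>\<theta>. \<theta> \<in> carrier_vec p \<Longrightarrow> FU \<theta> = F (lifted_rotation m L U *\<^sub>v \<theta>)"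
    and inv: "\<And>t j. t < T \<Longrightarrow> j \<in> {1..L + 1} \<Longrightarrow>
      invertible_mat (shampoo_left m L \<eta> \<epsilon> F \<theta>0 (Suc t) j) \<and>
      invertible_mat (shampoo_right m L \<eta> \<epsilon> F \<theta>0 (Suc t) j)"
    and t: "t \<le> T"
    and state: "shampoo_state m L \<eta> \<epsilon> F \<theta>0 t = (\<theta>, A, B)"
      "shampoo_state m L \<eta> \<epsilon> FU ((lifted_rotation m L U)\<^sup>T *\<^sub>v \<theta>0) t = (\<theta>', A', B')"
  shows "\<theta> \<in> carrier_vec p \<and> \<theta>' = (lifted_rotation m L U)\<^sup>T *\<^sub>v \<theta> \<and>
    (\<forall>j \<in> {1..L + 1}. psd (m j) (A j) \<and> psd (m (j - 1)) (B j) \<and> A' j = A j \<and>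
      B' j = layer_rotation m U j * B j * (layer_rotation m U j)\<^sup>T)"
  using t state
proof (induction t arbitrary: \<theta> A B \<theta>' A' B')
  case 0
  \<comment> \<open>A multiple of the identity is fixed by orthogonal conjugation, so both runs may
    start from the same preconditioners.\<close>
  have "V * (\<epsilon> \<cdot>\<^sub>m 1\<^sub>m n) * V\<^sup>T = \<epsilon> \<cdot>\<^sub>m 1\<^sub>m n" if "V \<in> orthogonal_group n" for V n
  proof -
    note V = orthogonal_groupD[OF that]
    have "V * (\<epsilon> \<cdot>\<^sub>m 1\<^sub>m n) = \<epsilon> \<cdot>\<^sub>m V"
      using mult_smult_distrib[of V n n "1\<^sub>m n" n \<epsilon>] V(1) by simp
    then show ?thesis using mult_smult_assoc_mat[OF V(1,2), of \<epsilon>] V(4) by simp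
  qed
  from this[OF layer_rotation_orthogonal[of U m, OF U]] show ?case
    using 0 \<theta>0 \<epsilon> by (auto simp: psd_scaled_one)
next
  case (Suc t)
  let ?Q = "lifted_rotation m L U" and ?V = "layer_rotation m U"
  note Uc = orthogonal_groupD(1,2)[OF U]
  have Q: "?Q \<in> orthogonal_group p" unfolding p_def by (rule lifted_rotation_orthogonal[of U m, OF U])
  note Qc = orthogonal_groupD(1,2)[OF Q]
  have QT: "?Q\<^sup>T = lifted_rotation m L (U\<^sup>T)" by (rule lifted_rotation_transpose[of U m, OF Uc(1)])
  have V: "?V j \<in> orthogonal_group (m (j - 1))" for j by (rule layer_rotation_orthogonal[of U m, OF U])
  have wQ: "weight m j (?Q\<^sup>T *\<^sub>v x) = weight m j x * (?V j)\<^sup>T"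
    and bQ: "bias m L j (?Q\<^sup>T *\<^sub>v x) = bias m L j x"
    if "x \<in> carrier_vec p" "j \<in> {1..L + 1}" for x j
    using that weight_lifted_rotation[of "U\<^sup>T" m x L j] bias_lifted_rotation[of "U\<^sup>T" m x L j] Uc
    by (auto simp: QT layer_rotation_transpose p_def)
  obtain \<theta>t At Bt where s: "shampoo_state m L \<eta> \<epsilon> F \<theta>0 t = (\<theta>t, At, Bt)"
    by (metis prod_cases3)
  obtain \<theta>t' At' Bt' where s': "shampoo_state m L \<eta> \<epsilon> FU (?Q\<^sup>T *\<^sub>v \<theta>0) t = (\<theta>t', At', Bt')"
    by (metis prod_cases3)
  have IH: "\<theta>t \<in> carrier_vec p" "\<theta>t' = ?Q\<^sup>T *\<^sub>v \<theta>t"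
    "\<And>j. j \<in> {1..L + 1} \<Longrightarrow> psd (m j) (At j)" "\<And>j. j \<in> {1..L + 1} \<Longrightarrow> psd (m (j - 1)) (Bt j)"
    "\<And>j. j \<in> {1..L + 1} \<Longrightarrow> At' j = At j"
    "\<And>j. j \<in> {1..L + 1} \<Longrightarrow> Bt' j = ?V j * Bt j * (?V j)\<^sup>T"
    using Suc.IH[OF _ s s'] Suc.prems(1) by auto
  obtain g where g: "has_gradient p F g \<theta>t"
    using diff[OF IH(1)] by (auto simp: vec_differentiable_def)
  then have gc: "g \<in> carrier_vec p" by (simp add: has_gradient_def)
  \<comment> \<open>\<open>?Q\<close> sends the rotated iterate back to \<open>\<theta>t\<close>,
    where the gradient of \<open>F\<close> is \<open>g\<close>, so the chain rule applies.\<close>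
  have "has_gradient p F g (?Q *\<^sub>v \<theta>t')" using g IH(1,2) orthogonal_cancel_vec(2)[OF Q] by simp
  then have "has_gradient p FU (?Q\<^sup>T *\<^sub>v g) \<theta>t'"
    by (intro has_gradient_orthogonal[where F = F, OF Q]) (use IH(1,2) Qc FU in simp_all)
  then have grad: "gradient p F \<theta>t = g" "gradient p FU \<theta>t' = ?Q\<^sup>T *\<^sub>v g"
    using g by (simp_all add: gradient_eqI)
  define G where "G j = weight m j g" for j
  \<comment> \<open>\<open>A\<close> and \<open>B\<close> belong to step \<open>Suc t\<close>: the
    current gradient enters the preconditioners before their roots are taken.\<close>
  define W where
    "W = (\<lambda>j. weight m j \<theta>t - \<eta> \<cdot>\<^sub>m (inv_fourth_root (A j) * G j * inv_fourth_root (B j)))"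
  have G: "G j \<in> carrier_mat (m j) (m (j - 1))" for j unfolding G_def by (rule weight_carrier)
  have A: "A = (\<lambda>j. At j + G j * (G j)\<^sup>T)" and B: "B = (\<lambda>j. Bt j + (G j)\<^sup>T * G j)"
    and \<theta>: "\<theta> = pack L W (\<lambda>j. bias m L j \<theta>t)"
    using Suc.prems(2) s grad(1) by (auto simp: Let_def G_def W_def p_def)
  define G' where "G' j = weight m j (?Q\<^sup>T *\<^sub>v g)" for j
  define W' where
    "W' = (\<lambda>j. weight m j \<theta>t' - \<eta> \<cdot>\<^sub>m (inv_fourth_root (A' j) * G' j * inv_fourth_root (B' j)))"
  have A': "A' = (\<lambda>j. At' j + G' j * (G' j)\<^sup>T)" and B': "B' = (\<lambda>j. Bt' j + (G' j)\<^sup>T * G' j)"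
    and \<theta>': "\<theta>' = pack L W' (\<lambda>j. bias m L j \<theta>t')"
    using Suc.prems(3) s' grad(2) by (auto simp: Let_def G'_def W'_def p_def)
  have psdA: "psd (m j) (A j)" and psdB: "psd (m (j - 1)) (B j)" if "j \<in> {1..L + 1}" for j
    using psd_add[OF IH(3)[OF that] psd_gram[OF G]] psd_add[OF IH(4)[OF that], of "(G j)\<^sup>T * G j"]
      psd_gram[of "(G j)\<^sup>T" "m (j - 1)" "m j"] G[of j] by (simp_all add: A B)
  \<comment> \<open>The accumulated matrices are semidefinite by construction and invertible by
    hypothesis, which \<open>Suc t \<le> T\<close> makes available at \<open>t\<close>.\<close>
  have spdA: "spd (m j) (A j)" and spdB: "spd (m (j - 1)) (B j)" if "j \<in> {1..L + 1}" for j
    using psd_invertible_imp_spd[OF psdA[OF that]] psd_invertible_imp_spd[OF psdB[OF that]]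
      inv[of t j] that Suc.prems(1,2) by (simp_all add: shampoo_left_def shampoo_right_def)
  have G': "G' j = G j * (?V j)\<^sup>T" if "j \<in> {1..L + 1}" for j
    using wQ[OF gc that] by (simp add: G_def G'_def)
  have AA: "A' j = A j" and BB: "B' j = ?V j * B j * (?V j)\<^sup>T" if j: "j \<in> {1..L + 1}" for j
  proof -
    have Btj: "Bt j \<in> carrier_mat (m (j - 1)) (m (j - 1))" using IH(4)[OF j] by (simp add: psd_def)
    show "A' j = A j" "B' j = ?V j * B j * (?V j)\<^sup>T"
      using gram_rotation[OF V G Btj]
      by (simp_all add: A A' B B' IH(5,6)[OF j] G'[OF j])
  qed
  have Ac: "inv_fourth_root (A j) \<in> carrier_mat (m j) (m j)"
    and Bc: "inv_fourth_root (B j) \<in> carrier_mat (m (j - 1)) (m (j - 1))" if "j \<in> {1..L + 1}" for j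
    using spdD(1)[OF inv_fourth_root_spd(1)] spdA[OF that] spdB[OF that] by auto
  have W: "W j \<in> carrier_mat (m j) (m (j - 1))" if "j \<in> {1..L + 1}" for j
    using weight_carrier[of m j \<theta>t] Ac[OF that] G[of j] Bc[OF that] by (auto simp: W_def)
  have WW: "W' j = W j * (?V j)\<^sup>T" if j: "j \<in> {1..L + 1}" for j
    unfolding W'_def W_def IH(2) wQ[OF IH(1) j] G'[OF j] AA[OF j] BB[OF j]
    by (rule shampoo_update_rotation[OF V weight_carrier G Ac[OF j] spdB[OF j]])
  have W': "W' j \<in> carrier_mat (m j) (m (j - 1))" if "j \<in> {1..L + 1}" for j
    unfolding WW[OF that] using W[OF that] orthogonal_groupD(2)[OF V] by simp
  have \<theta>c: "\<theta> \<in> carrier_vec p"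
    unfolding \<theta> p_def by (rule pack_carrier) (use W bias_carrier in auto)
  \<comment> \<open>Compared layer by layer: weights through \<open>WW\<close>, biases because
    neither run changes them and the rotation fixes them.\<close>
  have "\<theta>' = ?Q\<^sup>T *\<^sub>v \<theta>"
  proof (rule params_eqI[of _ m L])
    show "\<theta>' \<in> carrier_vec (num_params m L)"
      unfolding \<theta>' by (rule pack_carrier) (use W' bias_carrier in auto)
    show "?Q\<^sup>T *\<^sub>v \<theta> \<in> carrier_vec (num_params m L)" using Qc \<theta>c by (simp add: p_def)
    fix j assume "1 \<le> j" "j \<le> L + 1"
    then have j: "j \<in> {1..L + 1}" by simp
    have "weight m j \<theta>' = W' j" "weight m j \<theta> = W j"
      unfolding \<theta> \<theta>' by (rule weight_pack; use W W' j bias_carrier in auto)+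
    then show "weight m j \<theta>' = weight m j (?Q\<^sup>T *\<^sub>v \<theta>)"
      using wQ[OF \<theta>c j] WW[OF j] by simp
    have "bias m L j \<theta>' = bias m L j \<theta>t'" "bias m L j \<theta> = bias m L j \<theta>t"
      unfolding \<theta> \<theta>' by (rule bias_pack; use W W' j bias_carrier in auto)+
    then show "bias m L j \<theta>' = bias m L j (?Q\<^sup>T *\<^sub>v \<theta>)"
      using bQ[OF \<theta>c j] bQ[OF IH(1) j] IH(2) by simp
  qed
  then show ?case using \<theta>c psdA psdB AA BB by blast
qed

theorem theorem6:
  fixes m :: "nat \<Rightarrow> nat" and L T :: nat and \<sigma> :: "nat \<Rightarrow> real \<Rightarrow> real"
    and D :: "(real vec \<times> real) measure" and loss :: "real \<Rightarrow> real \<Rightarrow> real"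
    and U :: "real mat" and \<theta>0 :: "real vec" and \<eta> \<epsilon> :: real
  defines "d \<equiv> m 0"
    and "p \<equiv> num_params m L"
    and "f \<equiv> network m L \<sigma>"
    and "Q \<equiv> lifted_rotation m L U"
  defines "Loss \<equiv> expected_loss D loss f"
    and "LossU \<equiv> expected_loss (rotated_data d U D) loss f"
  defines "\<theta> \<equiv> shampoo m L \<eta> \<epsilon> Loss \<theta>0"
    and "\<theta>U \<equiv> shampoo m L \<eta> \<epsilon> LossU (Q\<^sup>T *\<^sub>v \<theta>0)"
  assumes "1 \<le> L"
    and "\<forall>j \<le> L + 1. 1 \<le> m j"
    and "m (L + 1) = 1"
    and "data_distribution d D"
    and "\<forall>\<theta>' \<in> carrier_vec p. integrable D (\<lambda>(x, y). loss y (f \<theta>' x))"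
    and "\<forall>\<theta>' \<in> carrier_vec p. vec_differentiable p Loss \<theta>'"
    and "U \<in> orthogonal_group d"
    and "0 < \<eta>" and "0 \<le> \<epsilon>"
    and "\<theta>0 \<in> carrier_vec p"
    and "\<forall>t < T. \<forall>j \<in> {1..L + 1}.
           invertible_mat (shampoo_left m L \<eta> \<epsilon> Loss \<theta>0 (Suc t) j) \<and>
           invertible_mat (shampoo_right m L \<eta> \<epsilon> Loss \<theta>0 (Suc t) j)"
  shows "Q \<in> orthogonal_group p \<and>
         (\<forall>t \<in> {1..T}. \<theta>U t = Q\<^sup>T *\<^sub>v \<theta> t) \<and>
         (\<forall>t \<in> {1..T}. \<forall>x \<in> carrier_vec d. f (\<theta>U t) x = f (\<theta> t) (U\<^sup>T *\<^sub>v x))"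
proof -
  have U: "U \<in> orthogonal_group (m 0)" using \<open>U \<in> orthogonal_group d\<close> by (simp add: d_def)
  note Uc = orthogonal_groupD(1,2)[OF U]
  \<comment> \<open>Valid at every parameter vector, hence also near each iterate, as the comparison
    of gradients requires.\<close>
  have LossU: "LossU \<theta>' = Loss (lifted_rotation m L U *\<^sub>v \<theta>')"
    if "\<theta>' \<in> carrier_vec (num_params m L)" for \<theta>'
    unfolding LossU_def Loss_def d_def f_def
    by (rule expected_loss_rotated_data)
      (use that assms Uc in \<open>auto simp: d_def p_def f_def\<close>)
  have iter: "\<theta> t \<in> carrier_vec p \<and> \<theta>U t = Q\<^sup>T *\<^sub>v \<theta> t" if "t \<le> T" for t
  proof -
    obtain x A B where s: "shampoo_state m L \<eta> \<epsilon> Loss \<theta>0 t = (x, A, B)" by (metis prod_cases3)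
    obtain x' A' B' where s': "shampoo_state m L \<eta> \<epsilon> LossU ((lifted_rotation m L U)\<^sup>T *\<^sub>v \<theta>0) t = (x', A', B')"
      by (metis prod_cases3)
    have "x \<in> carrier_vec (num_params m L) \<and> x' = (lifted_rotation m L U)\<^sup>T *\<^sub>v x"
      using shampoo_state_equivariant[OF U \<open>0 \<le> \<epsilon>\<close> _ _ LossU _ that s s'] assms(14,18,19)
      by (auto simp: p_def)
    then show ?thesis using s s' by (simp add: \<theta>_def \<theta>U_def shampoo_def Q_def p_def)
  qed
  \<comment> \<open>\<open>Q\<^sup>T\<close> is the lifted rotation of \<open>U\<^sup>T\<close>, so
    using the rotated parameters amounts to feeding \<open>U\<^sup>T x\<close> to the
    network.\<close>
  moreover have "f (Q\<^sup>T *\<^sub>v \<theta> t) x = f (\<theta> t) (U\<^sup>T *\<^sub>v x)"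
    if "t \<le> T" "x \<in> carrier_vec d" for t x
    using network_lifted_rotation[of "U\<^sup>T" m "\<theta> t" L x \<sigma>] iter[OF that(1)] that(2) Uc \<open>1 \<le> L\<close>
    by (simp add: f_def Q_def d_def p_def lifted_rotation_transpose)
  moreover have "Q \<in> orthogonal_group p"
    unfolding Q_def p_def by (rule lifted_rotation_orthogonal[of U m, OF U])
  ultimately show ?thesis by auto
qed

end
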